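(* Let $C\in Z\hat W$ be an admissible element, let $\zeta_C\colon Z(\mathsf{A})\to Z\hat W$ be an algebra homomorphism such that for every $z\in Z(\mathsf{A})$ there exists $a\in\mathsf{A}\otimes\mathcal{C}$ with $z\otimes1=\rho(\zeta_C(z))+\mathfrak{D}_Ca+a\mathfrak{D}_C$, let $\hat\tau$ be an irreducible representation of $\hat W$, and let $(\pi,X)$ be an $\mathsf{A}$-module with central character $\chi\colon Z(\mathsf{A})\to\mathbb{C}$ (i.e. every $z\in Z(\mathsf{A})$ acts on $X$ by the scalar $\chi(z)$). Suppose that $$\mathrm{Hom}_{\hat W}\big(\hat\tau,H(X,C)\big)\neq0 .$$ Then $\chi=\chi_{\hat\tau}$, where $\chi_{\hat\tau}(z)=\frac{1}{\dim\hat\tau}\mathrm{Tr}\big(\hat\tau(\zeta_C(z))\big)$ for $z\in Z(\mathsf{A})$.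
   Context: Setting. $(E,B)$ is a Euclidean space of dimension $n$ affording the reflection representation of a finite (real) reflection group $W\subset\mathsf{O}(E,B)$. $R\subset E^*$ is the root system, $R^\vee\subset E$ the dual root system with $\langle\alpha,\alpha^\vee\rangle=2$, where $\langle-,-\rangle\colon E^*\times E\to\mathbb{R}$ is the natural pairing; $s_\alpha(y)=y-\langle\alpha,y\rangle\alpha^\vee$. A positive system $R_+$ (with simple roots $\Delta$) is fixed, and $c\colon R_+\to\mathbb{C}$, $\alpha\mapsto c_\alpha$, is a $W$-invariant parameter function. Put $\mathfrak{h}=E_{\mathbb{C}}$, $\mathfrak{h}^*=E^*_{\mathbb{C}}$. Fix an orthonormal basis $y_1,\dots,y_n$ of $E$ and let $x_1,\dots,x_n$ be the dual basis of $E^*$. Rational Cherednik algebra $\mathsf{H}$: the quotient of the smash product $T(\mathfrak{h}^*\oplus\mathfrak{h})\#W$ by $[x,x']=0=[y,y']$ and $[y,x]=\langle x,y\rangle+\sum_{\alpha>0}c_\alpha\langle\alpha,y\rangle\langle x,\alpha^\vee\rangle s_\alpha$ for $x,x'\in\mathfrak{h}^*$, $y,y'\in\mathfrak{h}$. Dunkl angular momentum algebra $\mathsf{A}$: the associative subalgebra of $\mathsf{H}$ generated by $W$ and the elements $M_{ij}=x_iy_j-x_jy_i$, $1\le i<j\le n$; $Z(\mathsf{A})$ is its centre. $Z=\sum_{\alpha>0}c_\alpha s_\alpha\in\mathbb{C}W$ and $\phi=\tfrac12(2Z+n-2)$. Clifford algebra: $\mathcal{C}_{\mathbb{R}}$ is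 the real algebra generated by $E$ with relations $yy'+y'y=2B(y,y')$; $c_i\in\mathcal{C}_{\mathbb R}$ is the image of $y_i$, so $c_ic_j+c_jc_i=2\delta_{ij}$; $\mathcal{C}=\mathcal{C}_{\mathbb{R}}\otimes\mathbb{C}$. Let $\varepsilon$ be the automorphism of $\mathcal{C}_{\mathbb R}$ that is $-1$ on $E$, ${}^t$ the anti-automorphism that is the identity on $E$, and $\eta^*=\varepsilon(\eta^t)$. The group $\mathsf{Pin}$ consists of invertible $\eta\in\mathcal{C}_{\mathbb R}$ with $\varepsilon(\eta)y\eta^{-1}\in E$ for all $y\in E$ and $(\eta^*\eta)^2=1$; $p\colon\mathsf{Pin}\to\mathsf{O}(E,B)$, $p(\eta)y=\varepsilon(\eta)y\eta^{-1}$, is a double cover with kernel $\{\pm1\}$. $\tilde W=p^{-1}(W)$. The star operation on $\mathbb{C}\tilde W$ is the anti-linear extension of the restriction of $*$ to $\tilde W$. Let $w_0\in W$ be the longest element and $(-1)_{\mathfrak{h}}=-\mathrm{Id}\in\mathrm{End}(\mathfrak{h})$. If $w_0\ne(-1)_{\mathfrak h}$ set $\hat W=\tilde W$; if $w_0=(-1)_{\mathfrak h}$ set $\hat W=\tilde W\times C_2$, the generator of $C_2$ being also denoted $(-1)_{\mathfrak h}$. $\rho\colon\mathbb{C}\hat W\to\mathsf{A}\otimes\mathcal{C}$ is the algebra homomorphism with $\rho(\tilde w)=p(\tilde w)\otimes\tilde w$ for $\tilde w\in\tilde W$ ($\tilde w$ in the second factor viewed in $\mathcal{C}$), and, when $w_0=(-1)_{\mathfrak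 h}$, $\rho((-1)_{\mathfrak h})=(-1)_{\mathfrak h}\otimes1=w_0\otimes1$. The star operation is extended by $(-1)_{\mathfrak h}^*=(-1)_{\mathfrak h}$. $Z\hat W$ denotes the centre of $\mathbb{C}\hat W$. $C\in\mathbb{C}\hat W$ is called admissible if $C$ is central in $\mathbb{C}\hat W$ and $C^*=C$. The AMA-Dirac element is $\mathcal{D}=\sum_{i<j}M_{ij}\otimes c_ic_j\in\mathsf{A}\otimes\mathcal{C}$, and $\mathfrak{D}_C=(\mathcal{D}-\phi)+\rho(C)$ (with $\phi$ identified with $\phi\otimes1$). The element $\mathfrak{D}_C$ commutes with $\rho(\hat W)$. Dirac cohomology: fix an irreducible (complex) module $(\sigma,S)$ of $\mathcal{C}$. For an $\mathsf{A}$-module $(\pi,X)$ put $D_C=(\pi\otimes\sigma)(\mathfrak{D}_C)\in\mathrm{End}(X\otimes S)$ and $$H(X,C)=\frac{\ker(D_C)}{\ker(D_C)\cap\mathrm{im}(D_C)},$$ which is a $\hat W$-module via $(\pi\otimes\sigma)\circ\rho$. *)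

theory Defs
  imports "HOL-Analysis.Analysis" "HOL-Algebra.QuotRing" "HOL-Algebra.Module" "HOL-Algebra.Subrings"
begin

section \<open>Algebras over a field\<close>

text \<open>
  An algebra over \<open>'k\<close> is given by a \<^typ>\<open>('k, 'a) module\<close> record with all ring and scalar operations.
  The same record type is used for plain vector spaces; their fields \<^const>\<open>monoid.mult\<close> and \<^const>\<open>monoid.one\<close>
  are never used.
\<close>

definition field_ring :: "'k::field ring"
  where "field_ring = \<lparr>carrier = UNIV, monoid.mult = (*), monoid.one = 1, ring.zero = 0, ring.add = (+)\<rparr>"

definition real_space :: "(real, 'v::real_vector) module"
  where "real_space = \<lparr>carrier = UNIV, monoid.mult = undefined, monoid.one = undefined,
    ring.zero = 0, ring.add = (+), module.smult = (*\<^sub>R)\<rparr>"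

text \<open>\<open>\<complex> \<otimes> M\<close> for a real space or a real algebra \<open>M\<close>; the pair \<open>(a, b)\<close> stands for \<open>a + ib\<close>.\<close>

definition complexify :: "(real, 'a) module \<Rightarrow> (complex, 'a \<times> 'a) module"
  where "complexify M = \<lparr>carrier = carrier M \<times> carrier M,
    monoid.mult = (\<lambda>(a, b) (a', b').
      ((a \<otimes>\<^bsub>M\<^esub> a') \<ominus>\<^bsub>M\<^esub> (b \<otimes>\<^bsub>M\<^esub> b'), (a \<otimes>\<^bsub>M\<^esub> b') \<oplus>\<^bsub>M\<^esub> (b \<otimes>\<^bsub>M\<^esub> a'))),
    monoid.one = (\<one>\<^bsub>M\<^esub>, \<zero>\<^bsub>M\<^esub>),
    ring.zero = (\<zero>\<^bsub>M\<^esub>, \<zero>\<^bsub>M\<^esub>),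
    ring.add = (\<lambda>(a, b) (a', b'). (a \<oplus>\<^bsub>M\<^esub> a', b \<oplus>\<^bsub>M\<^esub> b')),
    module.smult = (\<lambda>z (a, b).
      ((Re z \<odot>\<^bsub>M\<^esub> a) \<oplus>\<^bsub>M\<^esub> ((- Im z) \<odot>\<^bsub>M\<^esub> b), (Re z \<odot>\<^bsub>M\<^esub> b) \<oplus>\<^bsub>M\<^esub> (Im z \<odot>\<^bsub>M\<^esub> a)))\<rparr>"

definition direct_sum :: "('k, 'a) module \<Rightarrow> ('k, 'b) module \<Rightarrow> ('k, 'a \<times> 'b) module"
  where "direct_sum M N = \<lparr>carrier = carrier M \<times> carrier N, monoid.mult = undefined, monoid.one = undefined,
    ring.zero = (\<zero>\<^bsub>M\<^esub>, \<zero>\<^bsub>N\<^esub>),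
    ring.add = (\<lambda>(a, b) (a', b'). (a \<oplus>\<^bsub>M\<^esub> a', b \<oplus>\<^bsub>N\<^esub> b')),
    module.smult = (\<lambda>r (a, b). (r \<odot>\<^bsub>M\<^esub> a, r \<odot>\<^bsub>N\<^esub> b))\<rparr>"

definition delta :: "'g \<Rightarrow> 'g \<Rightarrow> 'k::zero_neq_one"
  where "delta g = (\<lambda>x. if x = g then 1 else 0)"

text \<open>The bilinear extension of a map \<open>m\<close> on basis elements to finitely supported functions.\<close>

definition bilinear_ext ::
  "('p \<Rightarrow> 'q \<Rightarrow> 'r) \<Rightarrow> ('p \<Rightarrow> 'k::field) \<Rightarrow> ('q \<Rightarrow> 'k) \<Rightarrow> 'r \<Rightarrow> 'k"
  where "bilinear_ext m f g =
    (\<lambda>r. \<Sum>p | f p \<noteq> 0. \<Sum>q | g q \<noteq> 0. if m p q = r then f p * g q else 0)"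

definition monoid_algebra :: "('g, 'm) monoid_scheme \<Rightarrow> ('k::field, 'g \<Rightarrow> 'k) module"
  where "monoid_algebra G = \<lparr>carrier = {f. finite {g. f g \<noteq> 0} \<and> {g. f g \<noteq> 0} \<subseteq> carrier G},
    monoid.mult = bilinear_ext (monoid.mult G),
    monoid.one = delta \<one>\<^bsub>G\<^esub>,
    ring.zero = (\<lambda>_. 0),
    ring.add = (\<lambda>f f' x. f x + f' x),
    module.smult = (\<lambda>a f x. a * f x)\<rparr>"

text \<open>The quotient of an algebra by an ideal, or of a vector space by a subspace.\<close>

definition quotient :: "('k, 'a) module \<Rightarrow> 'a set \<Rightarrow> ('k, 'a set) module"
  where "quotient M I = \<lparr>carrier = a_rcosets\<^bsub>M\<^esub> I, monoid.mult = rcoset_mult M I,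
    monoid.one = I +>\<^bsub>M\<^esub> \<one>\<^bsub>M\<^esub>, ring.zero = I, ring.add = set_add M,
    module.smult = (\<lambda>a U. \<Union>u\<in>U. I +>\<^bsub>M\<^esub> (a \<odot>\<^bsub>M\<^esub> u))\<rparr>"

text \<open>The elements of \<open>F\<close> that have to vanish for \<open>\<iota> : V \<rightarrow> F\<close> to become linear.\<close>

definition linear_rels :: "('k, 'f) module \<Rightarrow> ('k, 'v) module \<Rightarrow> ('v \<Rightarrow> 'f) \<Rightarrow> 'f set"
  where "linear_rels F V \<iota> =
    {\<iota> (u \<oplus>\<^bsub>V\<^esub> v) \<ominus>\<^bsub>F\<^esub> (\<iota> u \<oplus>\<^bsub>F\<^esub> \<iota> v) | u v. u \<in> carrier V \<and> v \<in> carrier V} \<union>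
    {\<iota> (a \<odot>\<^bsub>V\<^esub> u) \<ominus>\<^bsub>F\<^esub> (a \<odot>\<^bsub>F\<^esub> \<iota> u) | a u. u \<in> carrier V}"

definition subspace_span :: "('k::field, 'a) module \<Rightarrow> 'a set \<Rightarrow> 'a set"
  where "subspace_span M S = \<Inter>{H. submodule H field_ring M \<and> S \<subseteq> H}"

definition subalgebra_generated :: "('k::field, 'a) module \<Rightarrow> 'a set \<Rightarrow> 'a set"
  where "subalgebra_generated M S =
    \<Inter>{H. subring H M \<and> submodule H field_ring M \<and> S \<subseteq> H}"

definition algebra_center :: "('k, 'a) module \<Rightarrow> 'a set"
  where "algebra_center M = {z \<in> carrier M. \<forall>a\<in>carrier M. z \<otimes>\<^bsub>M\<^esub> a = a \<otimes>\<^bsub>M\<^esub> z}"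

definition center_algebra :: "('k, 'a) module \<Rightarrow> ('k, 'a) module"
  where "center_algebra M = M\<lparr>carrier := algebra_center M\<rparr>"

definition algebra_hom :: "('k, 'a) module \<Rightarrow> ('k, 'b) module \<Rightarrow> ('a \<Rightarrow> 'b) set"
  where "algebra_hom M N =
    {h \<in> ring_hom M N. \<forall>a. \<forall>x\<in>carrier M. h (a \<odot>\<^bsub>M\<^esub> x) = a \<odot>\<^bsub>N\<^esub> h x}"

text \<open>
  The tensor product over \<open>'k\<close> is the free vector space on \<open>M \<times> N\<close> modulo the bilinearity relations.
  If \<open>M\<close> and \<open>N\<close> are algebras, these span an ideal of the monoid algebra of the multiplicative
  monoid \<open>M \<times>\<times> N\<close>, and the quotient carries the usual product.
\<close>

definition tensor_rels :: "('k::field, 'a) module \<Rightarrow> ('k, 'b) module \<Rightarrow> ('a \<times> 'b \<Rightarrow> 'k) set"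
  where "tensor_rels M N = (let F = monoid_algebra (M \<times>\<times> N) in
    subspace_span F
      ((\<Union>y\<in>carrier N. linear_rels F M (\<lambda>x. delta (x, y))) \<union>
       (\<Union>x\<in>carrier M. linear_rels F N (\<lambda>y. delta (x, y)))))"

definition tensor ::
  "('k::field, 'a) module \<Rightarrow> ('k, 'b) module \<Rightarrow> ('k, ('a \<times> 'b \<Rightarrow> 'k) set) module"
  where "tensor M N = quotient (monoid_algebra (M \<times>\<times> N)) (tensor_rels M N)"

definition tens ::
  "('k::field, 'a) module \<Rightarrow> ('k, 'b) module \<Rightarrow> 'a \<Rightarrow> 'b \<Rightarrow> ('a \<times> 'b \<Rightarrow> 'k) set"
  where "tens M N x y = tensor_rels M N +>\<^bsub>monoid_algebra (M \<times>\<times> N)\<^esub> delta (x, y)"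

section \<open>Representations\<close>

definition algebra_rep ::
  "('k::field, 'a) module \<Rightarrow> ('a \<Rightarrow> 'x \<Rightarrow> 'x) \<Rightarrow> ('k, 'x) module \<Rightarrow> bool"
  where "algebra_rep M \<pi> V \<longleftrightarrow> Module.module field_ring V \<and>
    (\<forall>a\<in>carrier M. \<forall>x\<in>carrier V. \<pi> a x \<in> carrier V) \<and>
    (\<forall>a\<in>carrier M. \<forall>x\<in>carrier V. \<forall>x'\<in>carrier V. \<pi> a (x \<oplus>\<^bsub>V\<^esub> x') = \<pi> a x \<oplus>\<^bsub>V\<^esub> \<pi> a x') \<and>
    (\<forall>a\<in>carrier M. \<forall>k. \<forall>x\<in>carrier V. \<pi> a (k \<odot>\<^bsub>V\<^esub> x) = k \<odot>\<^bsub>V\<^esub> \<pi> a x) \<and>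
    (\<forall>a\<in>carrier M. \<forall>b\<in>carrier M. \<forall>x\<in>carrier V. \<pi> (a \<oplus>\<^bsub>M\<^esub> b) x = \<pi> a x \<oplus>\<^bsub>V\<^esub> \<pi> b x) \<and>
    (\<forall>k. \<forall>a\<in>carrier M. \<forall>x\<in>carrier V. \<pi> (k \<odot>\<^bsub>M\<^esub> a) x = k \<odot>\<^bsub>V\<^esub> \<pi> a x) \<and>
    (\<forall>a\<in>carrier M. \<forall>b\<in>carrier M. \<forall>x\<in>carrier V. \<pi> (a \<otimes>\<^bsub>M\<^esub> b) x = \<pi> a (\<pi> b x)) \<and>
    (\<forall>x\<in>carrier V. \<pi> \<one>\<^bsub>M\<^esub> x = x)"

definition irreducible_rep ::
  "('k::field, 'a) module \<Rightarrow> ('a \<Rightarrow> 'x \<Rightarrow> 'x) \<Rightarrow> ('k, 'x) module \<Rightarrow> bool"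
  where "irreducible_rep M \<pi> V \<longleftrightarrow> algebra_rep M \<pi> V \<and> carrier V \<noteq> {\<zero>\<^bsub>V\<^esub>} \<and>
    (\<forall>U. submodule U field_ring V \<and> (\<forall>a\<in>carrier M. \<forall>u\<in>U. \<pi> a u \<in> U) \<longrightarrow>
      U = {\<zero>\<^bsub>V\<^esub>} \<or> U = carrier V)"

text \<open>
  \<open>(\<pi> \<otimes> \<sigma>)(t)\<close> as an operator on \<open>V \<otimes> S\<close>, that is
  \<open>(\<pi> \<otimes> \<sigma>)(a \<otimes> \<eta>)(x \<otimes> s) = \<pi>(a)x \<otimes> \<sigma>(\<eta>)s\<close> extended bilinearly. As in \<^const>\<open>rcoset_mult\<close>, the
  union ranges over all representatives of the two cosets.
\<close>

definition tensor_rep ::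
  "('k::field, 'x) module \<Rightarrow> ('k, 's) module \<Rightarrow> ('a \<Rightarrow> 'x \<Rightarrow> 'x) \<Rightarrow> ('b \<Rightarrow> 's \<Rightarrow> 's) \<Rightarrow>
   ('a \<times> 'b \<Rightarrow> 'k) set \<Rightarrow> ('x \<times> 's \<Rightarrow> 'k) set \<Rightarrow> ('x \<times> 's \<Rightarrow> 'k) set"
  where "tensor_rep V S \<pi> \<sigma> t u =
    (\<Union>f\<in>t. \<Union>g\<in>u. tensor_rels V S +>\<^bsub>monoid_algebra (V \<times>\<times> S)\<^esub>
       bilinear_ext (\<lambda>(a, \<eta>) (x, s). (\<pi> a x, \<sigma> \<eta> s)) f g)"

text \<open>
  A complex representation of dimension \<open>CARD('d)\<close> of a group, by matrices; \<open>matrix_rep_ext \<tau>\<close> is its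
  linear extension to the group algebra.
\<close>

definition matrix_rep :: "('g, 'm) monoid_scheme \<Rightarrow> ('g \<Rightarrow> complex^'d^'d) \<Rightarrow> bool"
  where "matrix_rep G \<tau> \<longleftrightarrow> \<tau> \<one>\<^bsub>G\<^esub> = mat 1 \<and>
    (\<forall>g\<in>carrier G. \<forall>h\<in>carrier G. \<tau> (g \<otimes>\<^bsub>G\<^esub> h) = \<tau> g ** \<tau> h)"

definition irreducible_matrix_rep ::
  "('g, 'm) monoid_scheme \<Rightarrow> ('g \<Rightarrow> complex^'d^'d) \<Rightarrow> bool"
  where "irreducible_matrix_rep G \<tau> \<longleftrightarrow> matrix_rep G \<tau> \<and>
    (\<forall>U. vec.subspace U \<and> (\<forall>g\<in>carrier G. \<forall>u\<in>U. \<tau> g *v u \<in> U) \<longrightarrow> U = {0} \<or> U = UNIV)"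

definition matrix_rep_ext ::
  "('g \<Rightarrow> complex^'d^'d) \<Rightarrow> ('g \<Rightarrow> complex) \<Rightarrow> complex^'d^'d"
  where "matrix_rep_ext \<tau> f = (\<Sum>g | f g \<noteq> 0. mat (f g) ** \<tau> g)"

text \<open>\<open>Hom\<^sub>G(\<tau>, Y)\<close> for a \<open>G\<close>-module \<open>Y\<close> with action \<open>act\<close>.\<close>

definition intertwiners ::
  "('g, 'm) monoid_scheme \<Rightarrow> ('g \<Rightarrow> complex^'d^'d) \<Rightarrow> ('g \<Rightarrow> 'y \<Rightarrow> 'y) \<Rightarrow> (complex, 'y) module \<Rightarrow>
   (complex^'d \<Rightarrow> 'y) set"
  where "intertwiners G \<tau> act Y = {F. (\<forall>v. F v \<in> carrier Y) \<and>
    (\<forall>v w. F (v + w) = F v \<oplus>\<^bsub>Y\<^esub> F w) \<and> (\<forall>k v. F (k *s v) = k \<odot>\<^bsub>Y\<^esub> F v) \<and>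
    (\<forall>g\<in>carrier G. \<forall>v. F (\<tau> g *v v) = act g (F v))}"

section \<open>Reflection groups and root systems\<close>

text \<open>
  The Euclidean space \<open>(E, B)\<close> is a type \<open>'a :: euclidean_space\<close> with its inner product, and \<open>E\<^sup>*\<close>
  is \<^typ>\<open>'a \<Rightarrow>\<^sub>L real\<close>. In the record, \<open>coroot \<alpha>\<close> is \<open>\<alpha>\<^sup>\<or>\<close>, \<open>onb 1, \<dots>, onb n\<close> is the
  orthonormal basis \<open>y\<^sub>1, \<dots>, y\<^sub>n\<close>, and \<open>dual_onb\<close> is the dual basis \<open>x\<^sub>1, \<dots>, x\<^sub>n\<close>.
\<close>

record (overloaded) 'a dunkl_data =
  roots :: "('a \<Rightarrow>\<^sub>L real) set"
  coroot :: "('a \<Rightarrow>\<^sub>L real) \<Rightarrow> 'a"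
  pos_roots :: "('a \<Rightarrow>\<^sub>L real) set"
  simple_roots :: "('a \<Rightarrow>\<^sub>L real) set"
  param :: "('a \<Rightarrow>\<^sub>L real) \<Rightarrow> complex"
  longest :: "'a \<Rightarrow> 'a"
  onb :: "nat \<Rightarrow> 'a"
  dual_onb :: "nat \<Rightarrow> ('a \<Rightarrow>\<^sub>L real)"

definition reflection :: "'a::euclidean_space dunkl_data \<Rightarrow> ('a \<Rightarrow>\<^sub>L real) \<Rightarrow> 'a \<Rightarrow> 'a"
  where "reflection D \<alpha> y = y - blinfun_apply \<alpha> y *\<^sub>R coroot D \<alpha>"

definition refl_word :: "'a::euclidean_space dunkl_data \<Rightarrow> ('a \<Rightarrow>\<^sub>L real) list \<Rightarrow> 'a \<Rightarrow> 'a"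
  where "refl_word D as = foldr (\<circ>) (map (reflection D) as) id"

text \<open>Reflections are involutions, so products of reflections already form a group.\<close>

definition refl_group :: "'a::euclidean_space dunkl_data \<Rightarrow> ('a \<Rightarrow> 'a) set"
  where "refl_group D = {refl_word D as | as. set as \<subseteq> roots D}"

definition dual_act :: "('a \<Rightarrow> 'a) \<Rightarrow> ('a::euclidean_space \<Rightarrow>\<^sub>L real) \<Rightarrow> ('a \<Rightarrow>\<^sub>L real)"
  where "dual_act w x = Blinfun (\<lambda>y. blinfun_apply x (inv_into UNIV w y))"

definition refl_length :: "'a::euclidean_space dunkl_data \<Rightarrow> ('a \<Rightarrow> 'a) \<Rightarrow> nat"
  where "refl_length D w =
    (LEAST k. \<exists>as. length as = k \<and> set as \<subseteq> simple_roots D \<and> refl_word D as = w)"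

definition root_system :: "'a::euclidean_space dunkl_data \<Rightarrow> bool"
  where "root_system D \<longleftrightarrow> finite (roots D) \<and>
    (\<forall>\<alpha>\<in>roots D. blinfun_apply \<alpha> (coroot D \<alpha>) = 2 \<and> orthogonal_transformation (reflection D \<alpha>) \<and>
      (\<forall>\<beta>\<in>roots D. dual_act (reflection D \<alpha>) \<beta> \<in> roots D) \<and>
      (\<forall>t. t *\<^sub>R \<alpha> \<in> roots D \<longrightarrow> t = 1 \<or> t = -1))"

definition positive_system :: "'a::euclidean_space dunkl_data \<Rightarrow> bool"
  where "positive_system D \<longleftrightarrow>
    (\<exists>v. (\<forall>\<alpha>\<in>roots D. blinfun_apply \<alpha> v \<noteq> 0) \<and>
      pos_roots D = {\<alpha> \<in> roots D. blinfun_apply \<alpha> v > 0})"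

definition simple_system :: "'a::euclidean_space dunkl_data \<Rightarrow> bool"
  where "simple_system D \<longleftrightarrow> simple_roots D \<subseteq> pos_roots D \<and> independent (simple_roots D) \<and>
    (\<forall>\<alpha>\<in>pos_roots D. \<exists>a. (\<forall>\<beta>\<in>simple_roots D. a \<beta> \<ge> 0) \<and>
      \<alpha> = (\<Sum>\<beta>\<in>simple_roots D. a \<beta> *\<^sub>R \<beta>))"

text \<open>
  \<open>W\<close>-invariance of \<open>c\<close> only has to mention \<open>w\<alpha> \<in> R\<^sub>+\<close>: if \<open>-w\<alpha> \<in> R\<^sub>+\<close>, then \<open>-w\<alpha> = w s\<^sub>\<alpha> \<alpha>\<close>.
  The roots are not required to span \<open>E\<^sup>*\<close>, and \<open>R\<close> need not be crystallographic.
\<close>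

definition dunkl_setting :: "'a::euclidean_space dunkl_data \<Rightarrow> bool"
  where "dunkl_setting D \<longleftrightarrow> root_system D \<and> positive_system D \<and> simple_system D \<and>
    (\<forall>w\<in>refl_group D. \<forall>\<alpha>\<in>pos_roots D. dual_act w \<alpha> \<in> pos_roots D \<longrightarrow>
      param D (dual_act w \<alpha>) = param D \<alpha>) \<and>
    longest D \<in> refl_group D \<and>
    (\<forall>w\<in>refl_group D. refl_length D w \<le> refl_length D (longest D)) \<and>
    (\<forall>i\<in>{1..DIM('a)}. \<forall>j\<in>{1..DIM('a)}. onb D i \<bullet> onb D j = (if i = j then 1 else 0)) \<and>
    (\<forall>i\<in>{1..DIM('a)}. \<forall>j\<in>{1..DIM('a)}.
      blinfun_apply (dual_onb D i) (onb D j) = (if i = j then 1 else 0))"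

section \<open>The rational Cherednik algebra and the Dunkl angular momentum algebra\<close>

type_synonym 'a h_dual = "('a \<Rightarrow>\<^sub>L real) \<times> ('a \<Rightarrow>\<^sub>L real)"
type_synonym 'a h = "'a \<times> 'a"
type_synonym 'a smash_word = "('a h_dual \<times> 'a h) list \<times> ('a \<Rightarrow> 'a)"
type_synonym 'a cherednik_elt = "('a smash_word \<Rightarrow> complex) set"

definition h_dual_plus_h :: "(complex, 'a::euclidean_space h_dual \<times> 'a h) module"
  where "h_dual_plus_h = direct_sum (complexify real_space) (complexify real_space)"

fun group_act ::
  "('a \<Rightarrow> 'a) \<Rightarrow> 'a::euclidean_space h_dual \<times> 'a h \<Rightarrow> 'a h_dual \<times> 'a h"
  where "group_act w ((x, x'), (y, y')) = ((dual_act w x, dual_act w x'), (w y, w y'))"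

fun pairing :: "'a::euclidean_space h_dual \<Rightarrow> 'a h \<Rightarrow> complex"
  where "pairing (x, x') (y, y') =
    Complex (blinfun_apply x y - blinfun_apply x' y') (blinfun_apply x y' + blinfun_apply x' y)"

text \<open>
  The semidirect product of the free monoid on the set \<open>V = \<hh>\<^sup>* \<oplus> \<hh>\<close> with \<open>W\<close>. Its monoid algebra
  modulo the linearity relations for the letters is the smash product \<open>T(V) # W\<close>.
\<close>

definition smash_monoid :: "'a::euclidean_space dunkl_data \<Rightarrow> 'a smash_word monoid"
  where "smash_monoid D = \<lparr>carrier = lists (carrier h_dual_plus_h) \<times> refl_group D,
    monoid.mult = (\<lambda>(u, w) (u', w'). (u @ map (group_act w) u', w \<circ> w')),
    monoid.one = ([], id)\<rparr>"

definition letter :: "'a::euclidean_space h_dual \<times> 'a h \<Rightarrow> 'a smash_word \<Rightarrow> complex"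
  where "letter v = delta ([v], id)"

definition group_letter :: "('a::euclidean_space \<Rightarrow> 'a) \<Rightarrow> 'a smash_word \<Rightarrow> complex"
  where "group_letter w = delta ([], w)"

definition x_letter :: "'a::euclidean_space h_dual \<Rightarrow> 'a smash_word \<Rightarrow> complex"
  where "x_letter x = letter (x, (0, 0))"

definition y_letter :: "'a::euclidean_space h \<Rightarrow> 'a smash_word \<Rightarrow> complex"
  where "y_letter y = letter ((0, 0), y)"

definition commutator :: "('k, 'a) module \<Rightarrow> 'a \<Rightarrow> 'a \<Rightarrow> 'a"
  where "commutator M a b = (a \<otimes>\<^bsub>M\<^esub> b) \<ominus>\<^bsub>M\<^esub> (b \<otimes>\<^bsub>M\<^esub> a)"

definition cherednik_ideal :: "'a::euclidean_space dunkl_data \<Rightarrow> ('a smash_word \<Rightarrow> complex) set"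
  where "cherednik_ideal D = (let F = monoid_algebra (smash_monoid D) in
    Idl\<^bsub>F\<^esub> (linear_rels F h_dual_plus_h letter \<union>
      {commutator F (x_letter x) (x_letter x') | x x'. True} \<union>
      {commutator F (y_letter y) (y_letter y') | y y'. True} \<union>
      {commutator F (y_letter y) (x_letter x) \<ominus>\<^bsub>F\<^esub>
        ((pairing x y \<odot>\<^bsub>F\<^esub> \<one>\<^bsub>F\<^esub>) \<oplus>\<^bsub>F\<^esub>
         (\<Oplus>\<^bsub>F\<^esub>\<alpha>\<in>pos_roots D.
            (param D \<alpha> * pairing (\<alpha>, 0) y * pairing x (coroot D \<alpha>, 0)) \<odot>\<^bsub>F\<^esub>
              group_letter (reflection D \<alpha>))) | x y. True}))"

definition cherednik :: "'a::euclidean_space dunkl_data \<Rightarrow> (complex, 'a cherednik_elt) module"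
  where "cherednik D = quotient (monoid_algebra (smash_monoid D)) (cherednik_ideal D)"

definition cherednik_class ::
  "'a::euclidean_space dunkl_data \<Rightarrow> ('a smash_word \<Rightarrow> complex) \<Rightarrow> 'a cherednik_elt"
  where "cherednik_class D f = cherednik_ideal D +>\<^bsub>monoid_algebra (smash_monoid D)\<^esub> f"

definition ch_group :: "'a::euclidean_space dunkl_data \<Rightarrow> ('a \<Rightarrow> 'a) \<Rightarrow> 'a cherednik_elt"
  where "ch_group D w = cherednik_class D (group_letter w)"

definition ch_x :: "'a::euclidean_space dunkl_data \<Rightarrow> nat \<Rightarrow> 'a cherednik_elt"
  where "ch_x D i = cherednik_class D (x_letter (dual_onb D i, 0))"

definition ch_y :: "'a::euclidean_space dunkl_data \<Rightarrow> nat \<Rightarrow> 'a cherednik_elt"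
  where "ch_y D i = cherednik_class D (y_letter (onb D i, 0))"

definition ang_mom :: "'a::euclidean_space dunkl_data \<Rightarrow> nat \<Rightarrow> nat \<Rightarrow> 'a cherednik_elt"
  where "ang_mom D i j =
    (ch_x D i \<otimes>\<^bsub>cherednik D\<^esub> ch_y D j) \<ominus>\<^bsub>cherednik D\<^esub> (ch_x D j \<otimes>\<^bsub>cherednik D\<^esub> ch_y D i)"

definition index_pairs :: "'a::euclidean_space dunkl_data \<Rightarrow> (nat \<times> nat) set"
  where "index_pairs D = {(i, j). 1 \<le> i \<and> i < j \<and> j \<le> DIM('a)}"

definition dam_algebra :: "'a::euclidean_space dunkl_data \<Rightarrow> (complex, 'a cherednik_elt) module"
  where "dam_algebra D = (cherednik D)\<lparr>carrier :=
    subalgebra_generated (cherednik D)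
      (ch_group D ` refl_group D \<union> {ang_mom D i j | i j. (i, j) \<in> index_pairs D})\<rparr>"

definition phi_elt :: "'a::euclidean_space dunkl_data \<Rightarrow> 'a cherednik_elt"
  where "phi_elt D = (let H = cherednik D in
    (1 / 2) \<odot>\<^bsub>H\<^esub>
      ((2 \<odot>\<^bsub>H\<^esub> (\<Oplus>\<^bsub>H\<^esub>\<alpha>\<in>pos_roots D. param D \<alpha> \<odot>\<^bsub>H\<^esub> ch_group D (reflection D \<alpha>)))
       \<oplus>\<^bsub>H\<^esub> ((of_nat DIM('a) - 2) \<odot>\<^bsub>H\<^esub> \<one>\<^bsub>H\<^esub>)))"

section \<open>The Clifford algebra and the Pin cover\<close>

type_synonym 'a cliff = "('a list \<Rightarrow> real) set"

definition word_monoid :: "'a list monoid"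
  where "word_monoid = \<lparr>carrier = UNIV, monoid.mult = (@), monoid.one = []\<rparr>"

definition clifford_ideal :: "('a::euclidean_space list \<Rightarrow> real) set"
  where "clifford_ideal = (let F = monoid_algebra word_monoid; \<iota> = (\<lambda>y. delta [y]) in
    Idl\<^bsub>F\<^esub> (linear_rels F real_space \<iota> \<union>
      {((\<iota> y \<otimes>\<^bsub>F\<^esub> \<iota> y') \<oplus>\<^bsub>F\<^esub> (\<iota> y' \<otimes>\<^bsub>F\<^esub> \<iota> y)) \<ominus>\<^bsub>F\<^esub> ((2 * (y \<bullet> y')) \<odot>\<^bsub>F\<^esub> \<one>\<^bsub>F\<^esub>) | y y'. True}))"

definition clifford :: "(real, 'a::euclidean_space cliff) module"
  where "clifford = quotient (monoid_algebra word_monoid) clifford_ideal"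

definition cl_vec :: "'a::euclidean_space \<Rightarrow> 'a cliff"
  where "cl_vec y = clifford_ideal +>\<^bsub>monoid_algebra word_monoid\<^esub> delta [y]"

definition clifford_cx :: "(complex, 'a::euclidean_space cliff \<times> 'a cliff) module"
  where "clifford_cx = complexify clifford"

definition cl_embed :: "'a::euclidean_space cliff \<Rightarrow> 'a cliff \<times> 'a cliff"
  where "cl_embed \<eta> = (\<eta>, \<zero>\<^bsub>clifford\<^esub>)"

text \<open>
  The maps \<open>\<epsilon>\<close> and \<open>\<^sup>t\<close> are induced from the (anti-)automorphisms \<open>y\<^sub>1\<cdots>y\<^sub>k \<mapsto> (-1)\<^sup>k y\<^sub>1\<cdots>y\<^sub>k\<close> and
  \<open>y\<^sub>1\<cdots>y\<^sub>k \<mapsto> y\<^sub>k\<cdots>y\<^sub>1\<close> of the free algebra, which preserve \<^const>\<open>clifford_ideal\<close> and therefore map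
  cosets onto cosets.
\<close>

definition cl_eps :: "'a cliff \<Rightarrow> 'a cliff"
  where "cl_eps \<eta> = (\<lambda>f l. (-1) ^ length l * f l) ` \<eta>"

definition cl_transpose :: "'a cliff \<Rightarrow> 'a cliff"
  where "cl_transpose \<eta> = (\<lambda>f l. f (rev l)) ` \<eta>"

definition cl_star :: "'a cliff \<Rightarrow> 'a cliff"
  where "cl_star \<eta> = cl_eps (cl_transpose \<eta>)"

definition pin :: "'a::euclidean_space cliff set"
  where "pin = {\<eta> \<in> Units clifford.
    (\<forall>y. cl_eps \<eta> \<otimes>\<^bsub>clifford\<^esub> cl_vec y \<otimes>\<^bsub>clifford\<^esub> inv\<^bsub>clifford\<^esub> \<eta> \<in> range cl_vec) \<and>
    (cl_star \<eta> \<otimes>\<^bsub>clifford\<^esub> \<eta>) [^]\<^bsub>clifford\<^esub> (2::nat) = \<one>\<^bsub>clifford\<^esub>}"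

definition pin_proj :: "'a::euclidean_space cliff \<Rightarrow> 'a \<Rightarrow> 'a"
  where "pin_proj \<eta> y = (THE y'. cl_vec y' =
    cl_eps \<eta> \<otimes>\<^bsub>clifford\<^esub> cl_vec y \<otimes>\<^bsub>clifford\<^esub> inv\<^bsub>clifford\<^esub> \<eta>)"

definition pin_cover :: "'a::euclidean_space dunkl_data \<Rightarrow> 'a cliff monoid"
  where "pin_cover D = \<lparr>carrier = {\<eta> \<in> pin. pin_proj \<eta> \<in> refl_group D},
    monoid.mult = monoid.mult clifford, monoid.one = \<one>\<^bsub>clifford\<^esub>\<rparr>"

text \<open>
  To have a single type for both cases, the group \<open>\<hat>W\<close> is \<open>\<tilde>W \<times> {1, -1}\<close> if \<open>w\<^sub>0 = -Id\<close>, with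
  \<open>(-1)\<^sub>\<hh> = (1, -1)\<close>, and \<open>\<tilde>W \<times> {1}\<close> otherwise.
\<close>

type_synonym 'a hat_elt = "'a cliff \<times> int"

definition hat_group :: "'a::euclidean_space dunkl_data \<Rightarrow> 'a hat_elt monoid"
  where "hat_group D = pin_cover D \<times>\<times>
    \<lparr>carrier = (if longest D = uminus then {1, -1} else {1}), monoid.mult = (*), monoid.one = 1\<rparr>"

definition hat_algebra ::
  "'a::euclidean_space dunkl_data \<Rightarrow> (complex, 'a hat_elt \<Rightarrow> complex) module"
  where "hat_algebra D = monoid_algebra (hat_group D)"

text \<open>Since \<open>*\<close> is an involution, \<open>(\<Sum>\<^sub>g f(g) g)\<^sup>* = \<Sum>\<^sub>g cnj (f(g)) g\<^sup>*\<close> has value \<open>cnj (f(g\<^sup>*))\<close> at \<open>g\<close>.\<close>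

definition hat_star :: "('a hat_elt \<Rightarrow> complex) \<Rightarrow> ('a hat_elt \<Rightarrow> complex)"
  where "hat_star f = (\<lambda>(\<eta>, s). cnj (f (cl_star \<eta>, s)))"

definition admissible :: "'a::euclidean_space dunkl_data \<Rightarrow> ('a hat_elt \<Rightarrow> complex) \<Rightarrow> bool"
  where "admissible D C \<longleftrightarrow> C \<in> algebra_center (hat_algebra D) \<and> hat_star C = C"

section \<open>The Dirac element and Dirac cohomology\<close>

type_synonym 'a dirac_elt = "('a cherednik_elt \<times> ('a cliff \<times> 'a cliff) \<Rightarrow> complex) set"

definition dam_cliff :: "'a::euclidean_space dunkl_data \<Rightarrow> (complex, 'a dirac_elt) module"
  where "dam_cliff D = tensor (dam_algebra D) clifford_cx"

definition dc_tens :: "'a::euclidean_space dunkl_data \<Rightarrow>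
    'a cherednik_elt \<Rightarrow> 'a cliff \<times> 'a cliff \<Rightarrow> 'a dirac_elt"
  where "dc_tens D = tens (dam_algebra D) clifford_cx"

definition rho_group :: "'a::euclidean_space dunkl_data \<Rightarrow> 'a hat_elt \<Rightarrow> 'a dirac_elt"
  where "rho_group D = (\<lambda>(\<eta>, s). dc_tens D
    (ch_group D (if s = 1 then pin_proj \<eta> else pin_proj \<eta> \<circ> longest D)) (cl_embed \<eta>))"

definition rho :: "'a::euclidean_space dunkl_data \<Rightarrow> ('a hat_elt \<Rightarrow> complex) \<Rightarrow> 'a dirac_elt"
  where "rho D f = (\<Oplus>\<^bsub>dam_cliff D\<^esub>g\<in>{g. f g \<noteq> 0}. f g \<odot>\<^bsub>dam_cliff D\<^esub> rho_group D g)"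

definition ama_dirac :: "'a::euclidean_space dunkl_data \<Rightarrow> 'a dirac_elt"
  where "ama_dirac D = (\<Oplus>\<^bsub>dam_cliff D\<^esub>p\<in>index_pairs D. case p of (i, j) \<Rightarrow>
    dc_tens D (ang_mom D i j)
      (cl_embed (cl_vec (onb D i)) \<otimes>\<^bsub>clifford_cx\<^esub> cl_embed (cl_vec (onb D j))))"

definition dirac :: "'a::euclidean_space dunkl_data \<Rightarrow> ('a hat_elt \<Rightarrow> complex) \<Rightarrow> 'a dirac_elt"
  where "dirac D C =
    (ama_dirac D \<ominus>\<^bsub>dam_cliff D\<^esub> dc_tens D (phi_elt D) \<one>\<^bsub>clifford_cx\<^esub>) \<oplus>\<^bsub>dam_cliff D\<^esub> rho D C"

text \<open>Elements of \<open>V \<otimes> S\<close> are cosets, so elements of the Dirac cohomology are cosets of cosets.\<close>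

context
  fixes D :: "'a::euclidean_space dunkl_data" and C :: "'a hat_elt \<Rightarrow> complex"
    and \<pi> :: "'a cherednik_elt \<Rightarrow> 'x \<Rightarrow> 'x" and V :: "(complex, 'x) module"
    and \<sigma> :: "'a cliff \<times> 'a cliff \<Rightarrow> 's \<Rightarrow> 's" and S :: "(complex, 's) module"
begin

definition dirac_op :: "('x \<times> 's \<Rightarrow> complex) set \<Rightarrow> ('x \<times> 's \<Rightarrow> complex) set"
  where "dirac_op = tensor_rep V S \<pi> \<sigma> (dirac D C)"

definition dirac_ker :: "('x \<times> 's \<Rightarrow> complex) set set"
  where "dirac_ker = {u \<in> carrier (tensor V S). dirac_op u = \<zero>\<^bsub>tensor V S\<^esub>}"

definition dirac_im :: "('x \<times> 's \<Rightarrow> complex) set set"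
  where "dirac_im = dirac_op ` carrier (tensor V S)"

definition dirac_cohomology :: "(complex, ('x \<times> 's \<Rightarrow> complex) set set) module"
  where "dirac_cohomology =
    quotient ((tensor V S)\<lparr>carrier := dirac_ker\<rparr>) (dirac_ker \<inter> dirac_im)"

definition dirac_cohomology_act ::
  "'a hat_elt \<Rightarrow> ('x \<times> 's \<Rightarrow> complex) set set \<Rightarrow> ('x \<times> 's \<Rightarrow> complex) set set"
  where "dirac_cohomology_act g U = (\<Union>u\<in>U. (dirac_ker \<inter> dirac_im) +>\<^bsub>tensor V S\<^esub>
    tensor_rep V S \<pi> \<sigma> (rho_group D g) u)"

end

definition normalized_character ::
  "('g \<Rightarrow> complex^'d^'d) \<Rightarrow> ('z \<Rightarrow> 'g \<Rightarrow> complex) \<Rightarrow> 'z \<Rightarrow> complex"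
  where "normalized_character \<tau> \<zeta> z = 1 / of_nat CARD('d) * trace (matrix_rep_ext \<tau> (\<zeta> z))"

end

theory Submission
  imports Defs "HOL-Computational_Algebra.Fundamental_Theorem_Algebra"
begin

text \<open>
  Let \<open>\<Phi> : \<hat>\<tau> \<rightarrow> H(X, C)\<close> be a nonzero intertwiner and let \<open>u \<in> ker D\<^sub>C\<close> represent \<open>\<Phi> v\<close>. The relation
  \<open>z \<otimes> 1 = \<rho>(\<zeta>\<^sub>C(z)) + \<DD>\<^sub>C a + a \<DD>\<^sub>C\<close> applied to \<open>u\<close> gives \<open>\<chi>(z) u \<equiv> \<rho>(\<zeta>\<^sub>C(z)) u\<close> modulo \<open>im D\<^sub>C\<close>, and
  \<open>\<rho>(\<zeta>\<^sub>C(z)) u\<close> represents \<open>\<Phi> (\<hat>\<tau>(\<zeta>\<^sub>C(z)) v)\<close>. By Schur's lemma \<open>\<hat>\<tau>(\<zeta>\<^sub>C(z))\<close> is the scalar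
  \<open>\<chi>\<^bsub>\<hat>\<tau>\<^esub>(z)\<close>, so \<open>(\<chi>(z) - \<chi>\<^bsub>\<hat>\<tau>\<^esub>(z)) u \<in> ker D\<^sub>C \<inter> im D\<^sub>C\<close>. If the scalar were nonzero, \<open>\<Phi> v\<close>
  would vanish for every \<open>v\<close>.
\<close>

section \<open>Vector spaces as modules\<close>

text \<open>All objects are explicit sets of cosets, so a short algebraic argument rests on a long
  verification of well-definedness. \<open>tensor_rep\<close> is a union over representatives; the
  substance of the tensor part is that this union is a single coset (\<open>T_coset\<close>), and
  from there on computations take place among finitely supported functions on pairs. The values of
  an intertwiner into cohomology are cosets of cosets and are handled through their members. The two
  halves of the anticommutator play different roles: on the kernel of the Dirac operator
  \<open>D\<^sub>C\<close> the term with \<open>D\<^sub>C\<close> applied before a is zero, while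
  the other one lands in the image. The resulting difference is also in the kernel because it is a
  multiple of u, which is why dividing by the intersection of kernel and image suffices. X may have
  infinite dimension, so the scalar is found on the side of \<tau>: an annihilating polynomial of
  one vector and the fundamental theorem of algebra give an eigenvector, irreducibility makes the
  matrix scalar, and its trace identifies the scalar with the normalized character.\<close>

lemma field_ring_simps [simp]:
  "carrier field_ring = UNIV" "a \<otimes>\<^bsub>field_ring\<^esub> b = a * b" "\<one>\<^bsub>field_ring\<^esub> = 1"
  "\<zero>\<^bsub>field_ring\<^esub> = 0" "a \<oplus>\<^bsub>field_ring\<^esub> b = a + b"
  by (simp_all add: field_ring_def)

lemma cring_field_ring: "cring (field_ring :: 'k::field ring)"
proof (rule cringI)
  show "abelian_group (field_ring :: 'k ring)"
  proof (rule abelian_groupI)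
    show "\<exists>y\<in>carrier field_ring. y \<oplus>\<^bsub>field_ring\<^esub> x = \<zero>\<^bsub>field_ring\<^esub>" for x :: 'k
      by (auto intro: exI[of _ "- x"])
  qed (simp_all add: algebra_simps)
  show "Group.comm_monoid (field_ring :: 'k ring)"
    by (rule comm_monoidI) (simp_all add: algebra_simps)
qed (simp_all add: algebra_simps)

lemma module_field_ringI:
  fixes M :: "('k::field, 'a) module"
  assumes "abelian_group M"
    and "\<And>a x. x \<in> carrier M \<Longrightarrow> a \<odot>\<^bsub>M\<^esub> x \<in> carrier M"
    and "\<And>a b x. x \<in> carrier M \<Longrightarrow> (a + b) \<odot>\<^bsub>M\<^esub> x = (a \<odot>\<^bsub>M\<^esub> x) \<oplus>\<^bsub>M\<^esub> (b \<odot>\<^bsub>M\<^esub> x)"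
    and "\<And>a x y. \<lbrakk>x \<in> carrier M; y \<in> carrier M\<rbrakk> \<Longrightarrow>
      a \<odot>\<^bsub>M\<^esub> (x \<oplus>\<^bsub>M\<^esub> y) = (a \<odot>\<^bsub>M\<^esub> x) \<oplus>\<^bsub>M\<^esub> (a \<odot>\<^bsub>M\<^esub> y)"
    and "\<And>a b x. x \<in> carrier M \<Longrightarrow> (a * b) \<odot>\<^bsub>M\<^esub> x = a \<odot>\<^bsub>M\<^esub> (b \<odot>\<^bsub>M\<^esub> x)"
    and "\<And>x. x \<in> carrier M \<Longrightarrow> 1 \<odot>\<^bsub>M\<^esub> x = x"
  shows "Module.module field_ring M"
  using assms by (intro moduleI cring_field_ring) simp_all

lemma module_minus_eq:
  fixes M :: "('k::field, 'a) module"
  assumes "Module.module field_ring M" "x \<in> carrier M" "y \<in> carrier M"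
  shows "x \<ominus>\<^bsub>M\<^esub> y = x \<oplus>\<^bsub>M\<^esub> ((-1) \<odot>\<^bsub>M\<^esub> y)"
proof -
  interpret module field_ring M by fact
  have "y \<oplus>\<^bsub>M\<^esub> ((-1) \<odot>\<^bsub>M\<^esub> y) = (1 + (-1)) \<odot>\<^bsub>M\<^esub> y"
    using assms(3) smult_l_distr[of 1 "-1" y] smult_one[of y] by simp
  also have "\<dots> = \<zero>\<^bsub>M\<^esub>" using smult_l_null[of y] assms(3) by simp
  finally have "\<ominus>\<^bsub>M\<^esub> y = (-1) \<odot>\<^bsub>M\<^esub> y"
    using assms(3) M.minus_equality[of "(-1) \<odot>\<^bsub>M\<^esub> y" y] M.a_comm smult_closed[of "-1" y] by simp
  then show ?thesis by (simp add: a_minus_def)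
qed

lemma submodule_subset: "submodule H R M \<Longrightarrow> H \<subseteq> carrier M"
  by (metis partial_object.select_convs(1) submodule_def subgroup.subset)

lemma submodule_zero: "submodule H R M \<Longrightarrow> \<zero>\<^bsub>M\<^esub> \<in> H"
  using subgroup.one_closed[of H "add_monoid M"] by (simp add: submodule_def)

lemma submodule_add: "submodule H R M \<Longrightarrow> x \<in> H \<Longrightarrow> y \<in> H \<Longrightarrow> x \<oplus>\<^bsub>M\<^esub> y \<in> H"
  using subgroup.m_closed[of H "add_monoid M" x y] by (simp add: submodule_def)

lemma submodule_smult:
  "submodule H field_ring M \<Longrightarrow> x \<in> H \<Longrightarrow> a \<odot>\<^bsub>M\<^esub> x \<in> H"
  using submodule.smult_closed[of H field_ring M a x] by simp

text \<open>Negation is multiplication by -1, so closure under scalars supplies the closure under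
  inverses that a subgroup has to have.\<close>

lemma submodule_field_ringI:
  fixes M :: "('k::field, 'a) module"
  assumes M: "Module.module field_ring M" and sub: "H \<subseteq> carrier M" and zero: "\<zero>\<^bsub>M\<^esub> \<in> H"
    and add: "\<And>x y. x \<in> H \<Longrightarrow> y \<in> H \<Longrightarrow> x \<oplus>\<^bsub>M\<^esub> y \<in> H"
    and smult: "\<And>a x. x \<in> H \<Longrightarrow> a \<odot>\<^bsub>M\<^esub> x \<in> H"
  shows "submodule H field_ring M"
proof -
  interpret module field_ring M by fact
  have "\<ominus>\<^bsub>M\<^esub> x \<in> H" if "x \<in> H" for x
  proof -
    have x: "x \<in> carrier M" using that sub by blast
    have "\<zero>\<^bsub>M\<^esub> \<ominus>\<^bsub>M\<^esub> x = \<zero>\<^bsub>M\<^esub> \<oplus>\<^bsub>M\<^esub> ((-1) \<odot>\<^bsub>M\<^esub> x)"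
      using module_minus_eq[OF M _ x] by simp
    then have "\<ominus>\<^bsub>M\<^esub> x = \<zero>\<^bsub>M\<^esub> \<oplus>\<^bsub>M\<^esub> ((-1) \<odot>\<^bsub>M\<^esub> x)"
      using x by (simp add: a_minus_def)
    then show ?thesis using add zero smult that by simp
  qed
  then show ?thesis
    using assms by (intro submoduleI) auto
qed

lemma submodule_Inter:
  fixes M :: "('k::field, 'a) module"
  assumes "Module.module field_ring M" "\<And>H. H \<in> \<H> \<Longrightarrow> submodule H field_ring M" "\<H> \<noteq> {}"
  shows "submodule (\<Inter>\<H>) field_ring M"
proof (rule submodule_field_ringI[OF assms(1)])
  show "\<Inter>\<H> \<subseteq> carrier M" using assms(2,3) submodule_subset by fastforce
qed (use assms(2) submodule_zero submodule_add submodule_smult in fastforce)+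

lemma carrier_submodule:
  "Module.module field_ring M \<Longrightarrow> submodule (carrier M) field_ring M"
  by (rule module.carrier_is_submodule)

lemma subspace_span:
  assumes "Module.module field_ring M" "S \<subseteq> carrier M"
  shows "submodule (subspace_span M S) field_ring M" "S \<subseteq> subspace_span M S"
  using assms carrier_submodule[OF assms(1)]
  by (auto simp: subspace_span_def intro!: submodule_Inter)

lemma subspace_span_minimal:
  "submodule H field_ring M \<Longrightarrow> S \<subseteq> H \<Longrightarrow> subspace_span M S \<subseteq> H"
  by (auto simp: subspace_span_def)

lemma submodule_finsum:
  fixes M :: "('k::field, 'a) module"
  assumes M: "Module.module field_ring M" and H: "submodule H field_ring M" and f: "f \<in> A \<rightarrow> H"
  shows "finsum M f A \<in> H"
proof -
  interpret module field_ring M by fact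
  have HM: "H \<subseteq> carrier M" by (rule submodule_subset[OF H])
  show ?thesis
    using f
  proof (induction A rule: infinite_finite_induct)
    case (insert x A)
    have "finsum M f (insert x A) = f x \<oplus>\<^bsub>M\<^esub> finsum M f A"
      using insert HM by (intro M.finsum_insert) auto
    with insert show ?case using submodule_add[OF H] by auto
  \<comment> \<open>A \<open>finsum\<close> over an infinite index set is zero by
    convention.\<close>
  qed (simp_all add: M.finsum_infinite submodule_zero[OF H])
qed

section \<open>Quotients\<close>

lemma abelian_subgroup_submodule:
  assumes "Module.module R M" "submodule I R M"
  shows "abelian_subgroup I M"
  using assms by (intro abelian_subgroupI3 additive_subgroupI)
    (auto simp: module_def submodule_def)

lemma coset_eqI:
  assumes "Module.module R M" "submodule I R M" "x \<in> carrier M" "y \<in> carrier M" "x \<ominus>\<^bsub>M\<^esub> y \<in> I"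
  shows "I +>\<^bsub>M\<^esub> x = I +>\<^bsub>M\<^esub> y"
proof -
  interpret abelian_subgroup I M by (rule abelian_subgroup_submodule) fact+
  show ?thesis
    using assms by (metis a_repr_independence' a_rcos_module a_minus_def)
qed

lemma mem_coset_iff:
  assumes "Module.module R M" "submodule I R M" "x \<in> carrier M"
  shows "y \<in> I +>\<^bsub>M\<^esub> x \<longleftrightarrow> y \<in> carrier M \<and> y \<ominus>\<^bsub>M\<^esub> x \<in> I"
proof -
  interpret abelian_subgroup I M by (rule abelian_subgroup_submodule) fact+
  show ?thesis
    using assms a_rcos_module[of x y] a_elemrcos_carrier[of x y] by (auto simp: a_minus_def)
qed

lemma coset_self:
  assumes "Module.module R M" "submodule I R M" "x \<in> carrier M"
  shows "x \<in> I +>\<^bsub>M\<^esub> x"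
proof -
  interpret abelian_subgroup I M by (rule abelian_subgroup_submodule) fact+
  show ?thesis using assms a_rcos_self by blast
qed

lemma coset_cong:
  assumes "Module.module R M" "submodule I R M" "x \<in> carrier M" "y \<in> I +>\<^bsub>M\<^esub> x"
  shows "I +>\<^bsub>M\<^esub> y = I +>\<^bsub>M\<^esub> x" "y \<in> carrier M"
  using assms coset_eqI[of R M I y x] by (auto simp: mem_coset_iff)

lemma coset_add:
  assumes "Module.module R M" "submodule I R M" "x \<in> carrier M" "y \<in> carrier M"
  shows "(I +>\<^bsub>M\<^esub> x) <+>\<^bsub>M\<^esub> (I +>\<^bsub>M\<^esub> y) = I +>\<^bsub>M\<^esub> (x \<oplus>\<^bsub>M\<^esub> y)"
proof -
  interpret abelian_subgroup I M by (rule abelian_subgroup_submodule) fact+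
  show ?thesis using assms a_rcos_sum by blast
qed

text \<open>The scalar product in \<open>quotient\<close> is a union over all u in the coset. Since
  a u - a x = a (u - x) stays in I, every set in that union is the same coset.\<close>

lemma coset_smult:
  fixes M :: "('k::field, 'a) module"
  assumes M: "Module.module field_ring M" and I: "submodule I field_ring M" and x: "x \<in> carrier M"
  shows "(\<Union>u\<in>I +>\<^bsub>M\<^esub> x. I +>\<^bsub>M\<^esub> (a \<odot>\<^bsub>M\<^esub> u)) = I +>\<^bsub>M\<^esub> (a \<odot>\<^bsub>M\<^esub> x)"
proof -
  interpret module field_ring M by fact
  have "I +>\<^bsub>M\<^esub> (a \<odot>\<^bsub>M\<^esub> u) = I +>\<^bsub>M\<^esub> (a \<odot>\<^bsub>M\<^esub> x)" if "u \<in> I +>\<^bsub>M\<^esub> x" for u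
  proof (rule coset_eqI[OF M I])
    have u: "u \<in> carrier M" "u \<ominus>\<^bsub>M\<^esub> x \<in> I"
      using that mem_coset_iff[OF M I x] by auto
    have "(a \<odot>\<^bsub>M\<^esub> u) \<ominus>\<^bsub>M\<^esub> (a \<odot>\<^bsub>M\<^esub> x) = a \<odot>\<^bsub>M\<^esub> (u \<ominus>\<^bsub>M\<^esub> x)"
      using u x smult_r_distr[of a u "\<ominus>\<^bsub>M\<^esub> x"] smult_r_minus[of a x] by (simp add: a_minus_def)
    with u show "(a \<odot>\<^bsub>M\<^esub> u) \<ominus>\<^bsub>M\<^esub> (a \<odot>\<^bsub>M\<^esub> x) \<in> I"
      using submodule_smult[OF I] by simp
    show "a \<odot>\<^bsub>M\<^esub> u \<in> carrier M" using u by simp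
  qed (use x in simp)
  then show ?thesis using coset_self[OF M I x] by blast
qed

lemma quotient_simps [simp]:
  "carrier (quotient M I) = a_rcosets\<^bsub>M\<^esub> I" "monoid.mult (quotient M I) = rcoset_mult M I"
  "\<one>\<^bsub>quotient M I\<^esub> = I +>\<^bsub>M\<^esub> \<one>\<^bsub>M\<^esub>" "\<zero>\<^bsub>quotient M I\<^esub> = I" "ring.add (quotient M I) = set_add M"
  "a \<odot>\<^bsub>quotient M I\<^esub> U = (\<Union>u\<in>U. I +>\<^bsub>M\<^esub> (a \<odot>\<^bsub>M\<^esub> u))"
  by (simp_all add: quotient_def)

lemma carrier_quotient: "a_rcosets\<^bsub>M\<^esub> I = (\<lambda>x. I +>\<^bsub>M\<^esub> x) ` carrier M"
  by (auto simp: A_RCOSETS_def' a_r_coset_def')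

text \<open>The additive part, shared by quotients of vector spaces and quotients of rings.\<close>

lemma abelian_group_quotient:
  assumes "abelian_subgroup I M"
  shows "abelian_group (quotient M I)"
proof -
  interpret abelian_subgroup I M by fact
  interpret Q: comm_group "\<lparr>carrier = a_rcosets\<^bsub>M\<^esub> I, monoid.mult = set_add M, one = I\<rparr>"
    by (rule a_factorgroup_is_comm_group[unfolded A_FactGroup_def'])
  show ?thesis
    by (rule abelian_groupI)
      (use Q.m_closed Q.one_closed Q.m_assoc Q.m_comm Q.l_one Q.l_inv_ex in simp_all)
qed

lemma module_quotient:
  fixes M :: "('k::field, 'a) module"
  assumes M: "Module.module field_ring M" and I: "submodule I field_ring M"
  shows "Module.module field_ring (quotient M I)"
proof (rule module_field_ringI)
  interpret module field_ring M by fact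
  show "abelian_group (quotient M I)"
    by (rule abelian_group_quotient[OF abelian_subgroup_submodule[OF assms]])
  note coset = coset_smult[OF M I] coset_add[OF M I]
  fix a b :: 'k and X Y
  assume "X \<in> carrier (quotient M I)"
  then obtain x where x: "X = I +>\<^bsub>M\<^esub> x" "x \<in> carrier M" by (auto simp: carrier_quotient)
  show "a \<odot>\<^bsub>quotient M I\<^esub> X \<in> carrier (quotient M I)"
    using x by (auto simp: carrier_quotient coset)
  show "(a + b) \<odot>\<^bsub>quotient M I\<^esub> X = (a \<odot>\<^bsub>quotient M I\<^esub> X) \<oplus>\<^bsub>quotient M I\<^esub> (b \<odot>\<^bsub>quotient M I\<^esub> X)"
    using x smult_l_distr[of a b x] by (simp add: coset)
  show "(a * b) \<odot>\<^bsub>quotient M I\<^esub> X = a \<odot>\<^bsub>quotient M I\<^esub> (b \<odot>\<^bsub>quotient M I\<^esub> X)"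
    using x smult_assoc1[of a b x] by (simp add: coset)
  show "1 \<odot>\<^bsub>quotient M I\<^esub> X = X"
    using x smult_one[of x] by (simp add: coset)
  assume "Y \<in> carrier (quotient M I)"
  then obtain y where y: "Y = I +>\<^bsub>M\<^esub> y" "y \<in> carrier M" by (auto simp: carrier_quotient)
  show "a \<odot>\<^bsub>quotient M I\<^esub> (X \<oplus>\<^bsub>quotient M I\<^esub> Y) =
      (a \<odot>\<^bsub>quotient M I\<^esub> X) \<oplus>\<^bsub>quotient M I\<^esub> (a \<odot>\<^bsub>quotient M I\<^esub> Y)"
    using x y smult_r_distr[of a x y] by (simp add: coset)
qed

text \<open>\<open>quotient\<close> agrees with \<open>Quot\<close> in every ring operation but is a
  different record, since it also carries scalars; the ring axioms are therefore carried over field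
  by field through \<open>eq\<close>.\<close>

lemma ring_quotient:
  assumes "ideal I M"
  shows "ring (quotient M I)"
proof -
  interpret ideal I M by fact
  have eq: "carrier (quotient M I) = carrier (M Quot I)" "monoid.mult (quotient M I) = monoid.mult (M Quot I)"
    "\<one>\<^bsub>quotient M I\<^esub> = \<one>\<^bsub>M Quot I\<^esub>" "\<zero>\<^bsub>quotient M I\<^esub> = \<zero>\<^bsub>M Quot I\<^esub>"
    "ring.add (quotient M I) = ring.add (M Quot I)"
    by (simp_all add: FactRing_def)
  interpret Q: ring "M Quot I" by (rule quotient_is_ring)
  show ?thesis
  proof (rule ringI)
    show "abelian_group (quotient M I)"
      by (rule abelian_group_quotient) (rule abelian_subgroup_axioms)
    show "Group.monoid (quotient M I)"
      by (rule monoidI) (unfold eq, simp_all add: Q.m_assoc)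
  qed (unfold eq, simp_all add: Q.l_distr Q.r_distr)
qed

section \<open>Monoid algebras\<close>

abbreviation supp :: "('g \<Rightarrow> 'k::zero) \<Rightarrow> 'g set"
  where "supp f \<equiv> {g. f g \<noteq> 0}"

lemma supp_delta [simp]: "supp (delta g :: 'g \<Rightarrow> 'k::zero_neq_one) = {g}"
  by (auto simp: delta_def)

text \<open>The definition sums over the exact supports. Larger finite index sets contribute only
  zero terms, and a common index set is what makes sums of functions with different supports
  comparable.\<close>

lemma bilinear_ext_eq:
  assumes "finite A" "finite B" "supp f \<subseteq> A" "supp g \<subseteq> B"
  shows "bilinear_ext m f g r = (\<Sum>p\<in>A. \<Sum>q\<in>B. if m p q = r then f p * g q else 0)"
proof -
  have "bilinear_ext m f g r = (\<Sum>p\<in>A. \<Sum>q | g q \<noteq> 0. if m p q = r then f p * g q else 0)"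
    unfolding bilinear_ext_def using assms(1,3)
    by (intro sum.mono_neutral_left ballI sum.neutral) auto
  also have "\<dots> = (\<Sum>p\<in>A. \<Sum>q\<in>B. if m p q = r then f p * g q else 0)"
    by (intro sum.cong refl sum.mono_neutral_left) (use assms in auto)
  finally show ?thesis .
qed

lemma supp_bilinear_ext:
  "supp (bilinear_ext m f g) \<subseteq> (\<lambda>(p, q). m p q) ` (supp f \<times> supp g)"
proof
  have "bilinear_ext m f g r = 0" if "r \<notin> (\<lambda>(p, q). m p q) ` (supp f \<times> supp g)" for r
    unfolding bilinear_ext_def using that by (intro sum.neutral ballI) auto
  then show "r \<in> supp (bilinear_ext m f g) \<Longrightarrow> r \<in> (\<lambda>(p, q). m p q) ` (supp f \<times> supp g)" for r
    by blast
qed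

lemma finite_supp_bilinear_ext:
  "finite (supp f) \<Longrightarrow> finite (supp g) \<Longrightarrow> finite (supp (bilinear_ext m f g))"
  by (rule finite_subset[OF supp_bilinear_ext]) auto

text \<open>Change of variables r = m p q, tested against a family h that is additive in the
  coefficient. With h picking out one coefficient of a further product it gives associativity; with
  h r a equal to a times \<tau>(r) v it gives multiplicativity of the extended
  representation.\<close>

lemma sum_bilinear_ext:
  fixes h :: "'r \<Rightarrow> 'k::field \<Rightarrow> 'c::comm_monoid_add"
  assumes fin: "finite A" "finite B" "supp f \<subseteq> A" "supp g \<subseteq> B"
    and C: "finite C" "\<And>p q. p \<in> A \<Longrightarrow> q \<in> B \<Longrightarrow> m p q \<in> C"
    and h: "\<And>r a b. h r (a + b) = h r a + h r b" "\<And>r. h r 0 = 0"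
  shows "(\<Sum>r\<in>C. h r (bilinear_ext m f g r)) = (\<Sum>p\<in>A. \<Sum>q\<in>B. h (m p q) (f p * g q))"
proof -
  have h_sum: "h r (sum a D) = (\<Sum>d\<in>D. h r (a d))" for r D and a :: "'d \<Rightarrow> 'k"
    by (induction D rule: infinite_finite_induct) (simp_all add: h)
  have "(\<Sum>r\<in>C. h r (bilinear_ext m f g r)) =
      (\<Sum>r\<in>C. \<Sum>p\<in>A. \<Sum>q\<in>B. if m p q = r then h r (f p * g q) else 0)"
    by (auto intro!: sum.cong simp: bilinear_ext_eq[OF fin] h_sum h)
  also have "\<dots> = (\<Sum>p\<in>A. \<Sum>r\<in>C. \<Sum>q\<in>B. if m p q = r then h r (f p * g q) else 0)"
    by (rule sum.swap)
  also have "\<dots> = (\<Sum>p\<in>A. \<Sum>q\<in>B. \<Sum>r\<in>C. if m p q = r then h r (f p * g q) else 0)"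
    by (intro sum.cong refl sum.swap)
  also have "\<dots> = (\<Sum>p\<in>A. \<Sum>q\<in>B. h (m p q) (f p * g q))"
    by (intro sum.cong refl) (simp add: C)
  finally show ?thesis .
qed

text \<open>Four separate maps are allowed so that one statement covers both the associativity of a
  monoid algebra, where all four agree, and the law (f f') g = f (f' g) for an action, where
  \<open>m2\<close> is a product and the others are the action. Associativity on the supports is
  enough, as only those pairs carry nonzero coefficients.\<close>

lemma bilinear_ext_assoc:
  assumes fin: "finite (supp f)" "finite (supp g)" "finite (supp h)"
    and assoc: "\<And>p q s. \<lbrakk>p \<in> supp f; q \<in> supp g; s \<in> supp h\<rbrakk> \<Longrightarrow> m1 (m2 p q) s = m3 p (m4 q s)"
  shows "bilinear_ext m1 (bilinear_ext m2 f g) h = bilinear_ext m3 f (bilinear_ext m4 g h)"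
proof
  fix r
  let ?A = "supp f" and ?B = "supp g" and ?S = "supp h"
  let ?C = "(\<lambda>(p, q). m2 p q) ` (?A \<times> ?B)" and ?D = "(\<lambda>(q, s). m4 q s) ` (?B \<times> ?S)"
  have finC: "finite ?C" "finite ?D" using fin by auto
  have "bilinear_ext m1 (bilinear_ext m2 f g) h r =
      (\<Sum>c\<in>?C. \<Sum>s\<in>?S. if m1 c s = r then bilinear_ext m2 f g c * h s else 0)"
    by (rule bilinear_ext_eq) (use fin supp_bilinear_ext[of m2 f g] in auto)
  also have "\<dots> = (\<Sum>p\<in>?A. \<Sum>q\<in>?B. \<Sum>s\<in>?S. if m1 (m2 p q) s = r then f p * g q * h s else 0)"
    by (rule sum_bilinear_ext[where h = "\<lambda>c a. \<Sum>s\<in>?S. if m1 c s = r then a * h s else 0"])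
      (use fin in \<open>auto simp: distrib_right simp flip: sum.distrib intro!: sum.cong sum.neutral\<close>)
  also have "\<dots> = (\<Sum>p\<in>?A. \<Sum>q\<in>?B. \<Sum>s\<in>?S. if m3 p (m4 q s) = r then f p * (g q * h s) else 0)"
    by (intro sum.cong refl) (auto simp: assoc mult.assoc)
  also have "\<dots> = (\<Sum>p\<in>?A. \<Sum>d\<in>?D. if m3 p d = r then f p * bilinear_ext m4 g h d else 0)"
    by (intro sum.cong refl sum_bilinear_ext[where h = "\<lambda>d a. if m3 _ d = r then f _ * a else 0", symmetric])
      (use fin in \<open>auto simp: distrib_left\<close>)
  also have "\<dots> = bilinear_ext m3 f (bilinear_ext m4 g h) r"
    by (rule bilinear_ext_eq[symmetric]) (use fin supp_bilinear_ext[of m4 g h] in auto)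
  finally show "bilinear_ext m1 (bilinear_ext m2 f g) h r = bilinear_ext m3 f (bilinear_ext m4 g h) r" .
qed

lemma bilinear_ext_delta_left:
  "bilinear_ext m (delta p) g r = (\<Sum>q\<in>supp g. if m p q = r then g q else 0)"
  unfolding bilinear_ext_def supp_delta by (simp add: delta_def cong: if_cong)

lemma bilinear_ext_delta_right:
  "bilinear_ext m f (delta q) r = (\<Sum>p\<in>supp f. if m p q = r then f p else 0)"
  unfolding bilinear_ext_def supp_delta by (simp add: delta_def cong: if_cong)

lemma bilinear_ext_delta: "bilinear_ext m (delta p) (delta q) = delta (m p q)"
  unfolding bilinear_ext_def supp_delta by (auto simp: delta_def)

lemma bilinear_ext_id_left:
  assumes "finite (supp f)" "\<And>p. p \<in> supp f \<Longrightarrow> m e p = p"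
  shows "bilinear_ext m (delta e) f = f"
proof
  show "bilinear_ext m (delta e) f r = f r" for r
  proof -
    have "(\<Sum>q\<in>supp f. if m e q = r then f q else 0) = (\<Sum>q\<in>supp f. if q = r then f q else 0)"
      using assms(2) by (intro sum.cong) auto
    then show ?thesis
      unfolding bilinear_ext_delta_left using assms(1) by auto
  qed
qed

lemma bilinear_ext_id_right:
  assumes "finite (supp f)" "\<And>p. p \<in> supp f \<Longrightarrow> m p e = p"
  shows "bilinear_ext m f (delta e) = f"
proof
  show "bilinear_ext m f (delta e) r = f r" for r
  proof -
    have "(\<Sum>q\<in>supp f. if m q e = r then f q else 0) = (\<Sum>q\<in>supp f. if q = r then f q else 0)"
      using assms(2) by (intro sum.cong) auto
    then show ?thesis
      unfolding bilinear_ext_delta_right using assms(1) by auto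
  qed
qed

lemma bilinear_ext_add_left:
  assumes "finite (supp f)" "finite (supp f')" "finite (supp g)"
  shows "bilinear_ext m (\<lambda>x. f x + f' x) g = (\<lambda>r. bilinear_ext m f g r + bilinear_ext m f' g r)"
proof
  fix r
  note eq = bilinear_ext_eq[of "supp f \<union> supp f'" "supp g" _ g m r]
  show "bilinear_ext m (\<lambda>x. f x + f' x) g r = bilinear_ext m f g r + bilinear_ext m f' g r"
    using assms by (subst (1 2 3) eq)
      (auto simp: distrib_right simp flip: sum.distrib intro!: sum.cong)
qed

lemma bilinear_ext_add_right:
  assumes "finite (supp f)" "finite (supp g)" "finite (supp g')"
  shows "bilinear_ext m f (\<lambda>x. g x + g' x) = (\<lambda>r. bilinear_ext m f g r + bilinear_ext m f g' r)"
proof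
  fix r
  note eq = bilinear_ext_eq[of "supp f" "supp g \<union> supp g'" f _ m r]
  show "bilinear_ext m f (\<lambda>x. g x + g' x) r = bilinear_ext m f g r + bilinear_ext m f g' r"
    using assms by (subst (1 2 3) eq)
      (auto simp: distrib_left simp flip: sum.distrib intro!: sum.cong)
qed

text \<open>The index sets of the sums depend on f, hence the case split: for a \<noteq> 0 the
  supports of f and a f coincide, and for a = 0 both sides vanish.\<close>

lemma bilinear_ext_smult_left:
  "bilinear_ext m (\<lambda>x. a * f x) g = (\<lambda>r. a * bilinear_ext m f g r)"
  by (cases "a = 0") (auto simp: bilinear_ext_def sum_distrib_left fun_eq_iff mult.assoc intro!: sum.cong)

lemma bilinear_ext_smult_right:
  "bilinear_ext m f (\<lambda>x. a * g x) = (\<lambda>r. a * bilinear_ext m f g r)"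
  by (cases "a = 0") (auto simp: bilinear_ext_def sum_distrib_left fun_eq_iff mult_ac intro!: sum.cong)

lemma bilinear_ext_zero [simp]:
  "bilinear_ext m (\<lambda>_. 0) g = (\<lambda>_. 0)" "bilinear_ext m f (\<lambda>_. 0) = (\<lambda>_. 0)"
  by (simp_all add: bilinear_ext_def fun_eq_iff)

lemma monoid_algebra_simps [simp]:
  "monoid.mult (monoid_algebra G) = bilinear_ext (monoid.mult G)"
  "\<one>\<^bsub>monoid_algebra G\<^esub> = delta \<one>\<^bsub>G\<^esub>"
  "\<zero>\<^bsub>monoid_algebra G\<^esub> = (\<lambda>_. 0)"
  "f \<oplus>\<^bsub>monoid_algebra G\<^esub> g = (\<lambda>x. f x + g x)"
  "a \<odot>\<^bsub>monoid_algebra G\<^esub> f = (\<lambda>x. a * f x)"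
  by (simp_all add: monoid_algebra_def)

lemma mem_monoid_algebra:
  "f \<in> carrier (monoid_algebra G) \<longleftrightarrow> finite (supp f) \<and> supp f \<subseteq> carrier G"
  by (simp add: monoid_algebra_def)

lemma zero_mem_monoid_algebra: "(\<lambda>_. 0) \<in> carrier (monoid_algebra G)"
  by (simp add: mem_monoid_algebra)

lemma delta_mem_monoid_algebra: "delta g \<in> carrier (monoid_algebra G) \<longleftrightarrow> g \<in> carrier G"
  by (simp add: mem_monoid_algebra)

lemma add_mem_monoid_algebra:
  assumes "f \<in> carrier (monoid_algebra G)" "g \<in> carrier (monoid_algebra G)"
  shows "(\<lambda>x. f x + g x) \<in> carrier (monoid_algebra G)"
proof -
  have "supp (\<lambda>x. f x + g x) \<subseteq> supp f \<union> supp g" by auto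
  with assms show ?thesis
    unfolding mem_monoid_algebra by (meson finite_Un finite_subset le_sup_iff order_trans)
qed

lemma smult_mem_monoid_algebra:
  assumes "f \<in> carrier (monoid_algebra G)"
  shows "(\<lambda>x. a * f x) \<in> carrier (monoid_algebra G)"
proof -
  have "supp (\<lambda>x. a * f x) \<subseteq> supp f" by auto
  with assms show ?thesis
    unfolding mem_monoid_algebra by (meson finite_subset order_trans)
qed

lemma bilinear_ext_mem_monoid_algebra:
  assumes "f \<in> carrier (monoid_algebra G)" "g \<in> carrier (monoid_algebra H)"
    and "\<And>p q. p \<in> carrier G \<Longrightarrow> q \<in> carrier H \<Longrightarrow> m p q \<in> carrier K"
  shows "bilinear_ext m f g \<in> carrier (monoid_algebra K)"
  using assms finite_supp_bilinear_ext[of f g m] supp_bilinear_ext[of m f g]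
  unfolding mem_monoid_algebra by fastforce

lemma module_monoid_algebra: "Module.module field_ring (monoid_algebra G :: ('k::field, _) module)"
proof (rule module_field_ringI)
  show "abelian_group (monoid_algebra G :: ('k, _) module)"
  proof (rule abelian_groupI)
    fix f :: "_ \<Rightarrow> 'k"
    assume "f \<in> carrier (monoid_algebra G)"
    then show "\<exists>g\<in>carrier (monoid_algebra G). g \<oplus>\<^bsub>monoid_algebra G\<^esub> f = \<zero>\<^bsub>monoid_algebra G\<^esub>"
      using smult_mem_monoid_algebra[of f G "-1"] by (intro bexI[of _ "\<lambda>x. -1 * f x"]) auto
  qed (auto simp: zero_mem_monoid_algebra add_mem_monoid_algebra add_ac)
qed (auto simp: smult_mem_monoid_algebra distrib_left distrib_right mult.assoc)

lemma monoid_algebra_minus: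
  assumes "f \<in> carrier (monoid_algebra G)" "g \<in> carrier (monoid_algebra G)"
  shows "f \<ominus>\<^bsub>monoid_algebra G\<^esub> g = (\<lambda>x. f x - g x)"
  using module_minus_eq[OF module_monoid_algebra assms] by simp

lemma minus_mem_monoid_algebra:
  assumes "f \<in> carrier (monoid_algebra G)" "g \<in> carrier (monoid_algebra G)"
  shows "(\<lambda>x. f x - g x) \<in> carrier (monoid_algebra G)"
  using add_mem_monoid_algebra[OF assms(1) smult_mem_monoid_algebra[OF assms(2), of "-1"]] by simp

text \<open>A finitely supported function is built up one basis element at a time. The induction
  runs over finite sets A with f cut off outside A, and it carries membership in the carrier along
  because \<open>add\<close> asks for it.\<close>

lemma monoid_algebra_induct [consumes 1, case_names zero add]:
  assumes "f \<in> carrier (monoid_algebra G)"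
    and zero: "P (\<lambda>_. 0)"
    and add: "\<And>f a g. \<lbrakk>f \<in> carrier (monoid_algebra G); g \<in> carrier G; P f\<rbrakk> \<Longrightarrow>
      P (\<lambda>x. f x + a * delta g x)"
  shows "P f"
proof -
  have "P (\<lambda>x. if x \<in> A then f x else 0) \<and> (\<lambda>x. if x \<in> A then f x else 0) \<in> carrier (monoid_algebra G)"
    if "finite A" "A \<subseteq> carrier G" for A
    using that
  proof (induction A rule: finite_induct)
    case empty
    then show ?case using zero by (simp add: zero_mem_monoid_algebra)
  next
    case (insert g A)
    have eq: "(\<lambda>x. if x \<in> insert g A then f x else 0) =
        (\<lambda>x. (if x \<in> A then f x else 0) + f g * delta g x)"
      using insert(2) by (auto simp: delta_def)
    show ?case
      unfolding eq using insert
      by (auto intro!: add add_mem_monoid_algebra smult_mem_monoid_algebra simp: delta_mem_monoid_algebra)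
  qed
  from this[of "supp f"] have "P (\<lambda>x. if x \<in> supp f then f x else 0)"
    using assms(1) by (simp add: mem_monoid_algebra)
  moreover have "(\<lambda>x. if x \<in> supp f then f x else 0) = f" by auto
  ultimately show ?thesis by simp
qed

lemma ring_monoid_algebra:
  assumes "Group.monoid G"
  shows "ring (monoid_algebra G :: ('k::field, _) module)"
proof (rule ringI)
  interpret G: monoid G by fact
  show "abelian_group (monoid_algebra G :: ('k, _) module)"
    using module_monoid_algebra by (rule module.axioms)
  show "Group.monoid (monoid_algebra G :: ('k, _) module)"
  proof (rule monoidI)
    fix f g h :: "_ \<Rightarrow> 'k"
    assume f: "f \<in> carrier (monoid_algebra G)"
    show "\<one>\<^bsub>monoid_algebra G\<^esub> \<otimes>\<^bsub>monoid_algebra G\<^esub> f = f" "f \<otimes>\<^bsub>monoid_algebra G\<^esub> \<one>\<^bsub>monoid_algebra G\<^esub> = f"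
      using f by (auto simp: mem_monoid_algebra intro!: bilinear_ext_id_left bilinear_ext_id_right)
    assume g: "g \<in> carrier (monoid_algebra G)"
    show "f \<otimes>\<^bsub>monoid_algebra G\<^esub> g \<in> carrier (monoid_algebra G)"
      using f g by (auto intro: bilinear_ext_mem_monoid_algebra)
    assume h: "h \<in> carrier (monoid_algebra G)"
    show "f \<otimes>\<^bsub>monoid_algebra G\<^esub> g \<otimes>\<^bsub>monoid_algebra G\<^esub> h = f \<otimes>\<^bsub>monoid_algebra G\<^esub> (g \<otimes>\<^bsub>monoid_algebra G\<^esub> h)"
      using f g h unfolding monoid_algebra_simps mem_monoid_algebra
      by (intro bilinear_ext_assoc G.m_assoc) auto
  qed (simp add: delta_mem_monoid_algebra)
qed (auto simp: mem_monoid_algebra bilinear_ext_add_left bilinear_ext_add_right)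

text \<open>Scaling by a is left multiplication by a times the unit, so an ideal is closed under
  scalars.\<close>

lemma ideal_monoid_algebra_submodule:
  fixes I :: "('g \<Rightarrow> 'k::field) set"
  assumes "Group.monoid G" "ideal I (monoid_algebra G)"
  shows "submodule I field_ring (monoid_algebra G)"
proof (rule submodule_field_ringI[OF module_monoid_algebra])
  interpret G: monoid G by fact
  interpret ideal I "monoid_algebra G" by fact
  show "I \<subseteq> carrier (monoid_algebra G)" by (rule a_subset)
  fix a :: 'k and f
  assume f: "f \<in> I"
  then have "f \<in> carrier (monoid_algebra G)" using a_subset by blast
  then have "bilinear_ext (monoid.mult G) (delta \<one>\<^bsub>G\<^esub>) f = f"
    by (intro bilinear_ext_id_left) (auto simp: mem_monoid_algebra)
  then have "bilinear_ext (monoid.mult G) (\<lambda>x. a * delta \<one>\<^bsub>G\<^esub> x) f = (\<lambda>x. a * f x)"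
    by (simp add: bilinear_ext_smult_left)
  moreover have "(\<lambda>x. a * delta \<one>\<^bsub>G\<^esub> x) \<in> carrier (monoid_algebra G)"
    by (auto intro!: smult_mem_monoid_algebra simp: delta_mem_monoid_algebra)
  ultimately show "a \<odot>\<^bsub>monoid_algebra G\<^esub> f \<in> I"
    using I_l_closed[OF f, of "\<lambda>x. a * delta \<one>\<^bsub>G\<^esub> x"] by simp
qed (use ideal.axioms(1)[OF assms(2)] additive_subgroup.zero_closed additive_subgroup.a_closed in fastforce)+

text \<open>Common to the Cherednik algebra and the Clifford algebra, both of which are presented by
  relations in the algebra of a monoid of words.\<close>

lemma quotient_monoid_algebra:
  fixes S :: "('g \<Rightarrow> 'k::field) set"
  assumes "Group.monoid G" "S \<subseteq> carrier (monoid_algebra G)"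
  defines "Q \<equiv> quotient (monoid_algebra G) (Idl\<^bsub>monoid_algebra G\<^esub> S)"
  shows "ring Q" "Module.module field_ring Q"
    and "f \<in> carrier (monoid_algebra G) \<Longrightarrow> Idl\<^bsub>monoid_algebra G\<^esub> S +>\<^bsub>monoid_algebra G\<^esub> f \<in> carrier Q"
proof -
  interpret ring "monoid_algebra G :: ('k, _) module" by (rule ring_monoid_algebra) fact
  have ideal: "ideal (Idl\<^bsub>monoid_algebra G\<^esub> S) (monoid_algebra G)"
    by (rule genideal_ideal) fact
  show "ring Q" unfolding Q_def by (rule ring_quotient[OF ideal])
  show "Module.module field_ring Q" unfolding Q_def
    by (intro module_quotient module_monoid_algebra ideal_monoid_algebra_submodule assms(1) ideal)
  show "f \<in> carrier (monoid_algebra G) \<Longrightarrow> Idl\<^bsub>monoid_algebra G\<^esub> S +>\<^bsub>monoid_algebra G\<^esub> f \<in> carrier Q"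
    unfolding Q_def by (simp add: carrier_quotient)
qed

section \<open>Tensor products\<close>

lemma linear_rels_subset:
  assumes "Module.module field_ring F" "Module.module field_ring V" "\<iota> \<in> carrier V \<rightarrow> carrier F"
  shows "linear_rels F V \<iota> \<subseteq> carrier F"
proof -
  interpret F: module field_ring F by fact
  interpret V: module field_ring V by fact
  show ?thesis
    using assms(3) unfolding linear_rels_def by (fastforce intro!: F.minus_closed)
qed

text \<open>Subtraction in an abstract module goes through an inverse within the carrier. Once all
  terms are known to lie there, the relations become pointwise differences of functions, which
  simplification can handle.\<close>

lemma linear_rels_monoid_algebra:
  fixes \<iota> :: "'v \<Rightarrow> 'g \<Rightarrow> 'k::field"
  assumes "Module.module field_ring V" "\<iota> \<in> carrier V \<rightarrow> carrier (monoid_algebra G)"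
  shows "linear_rels (monoid_algebra G) V \<iota> =
    {\<lambda>r. \<iota> (u \<oplus>\<^bsub>V\<^esub> v) r - (\<iota> u r + \<iota> v r) | u v. u \<in> carrier V \<and> v \<in> carrier V} \<union>
    {\<lambda>r. \<iota> (a \<odot>\<^bsub>V\<^esub> u) r - a * \<iota> u r | a u. u \<in> carrier V}"
proof -
  interpret V: module field_ring V by fact
  have \<iota>: "\<iota> u \<in> carrier (monoid_algebra G)" if "u \<in> carrier V" for u
    using assms(2) that by blast
  have 1: "\<iota> (u \<oplus>\<^bsub>V\<^esub> v) \<ominus>\<^bsub>monoid_algebra G\<^esub> (\<iota> u \<oplus>\<^bsub>monoid_algebra G\<^esub> \<iota> v) =
      (\<lambda>r. \<iota> (u \<oplus>\<^bsub>V\<^esub> v) r - (\<iota> u r + \<iota> v r))"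
    if "u \<in> carrier V" "v \<in> carrier V" for u v
    using that \<iota> monoid_algebra_minus[OF \<iota> add_mem_monoid_algebra[OF \<iota> \<iota>]] by simp
  have 2: "\<iota> (a \<odot>\<^bsub>V\<^esub> u) \<ominus>\<^bsub>monoid_algebra G\<^esub> (a \<odot>\<^bsub>monoid_algebra G\<^esub> \<iota> u) =
      (\<lambda>r. \<iota> (a \<odot>\<^bsub>V\<^esub> u) r - a * \<iota> u r)"
    if "u \<in> carrier V" for a u
    using that \<iota> monoid_algebra_minus[OF \<iota> smult_mem_monoid_algebra[OF \<iota>]] by simp
  show ?thesis
    unfolding linear_rels_def using 1 2 by (intro arg_cong2[of _ _ _ _ "(\<union>)"]) (metis (lifting))+
qed

lemma tensor_rels_gens_subset:
  fixes M :: "('k::field, 'a) module" and N :: "('k, 'b) module"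
  assumes "Module.module field_ring M" "Module.module field_ring N"
  shows "(\<Union>y\<in>carrier N. linear_rels (monoid_algebra (M \<times>\<times> N)) M (\<lambda>x. delta (x, y))) \<union>
       (\<Union>x\<in>carrier M. linear_rels (monoid_algebra (M \<times>\<times> N)) N (\<lambda>y. delta (x, y)))
     \<subseteq> carrier (monoid_algebra (M \<times>\<times> N) :: ('k, _) module)"
  by (intro Un_least UN_least linear_rels_subset assms module_monoid_algebra)
    (auto simp: delta_mem_monoid_algebra)

lemma submodule_tensor_rels:
  assumes "Module.module field_ring M" "Module.module field_ring N"
  shows "submodule (tensor_rels M N) field_ring (monoid_algebra (M \<times>\<times> N))"
  unfolding tensor_rels_def Let_def
  by (intro subspace_span tensor_rels_gens_subset module_monoid_algebra assms)

lemma tensor_rels_gens: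
  fixes M :: "('k::field, 'a) module" and N :: "('k, 'b) module"
  assumes M: "Module.module field_ring M" and N: "Module.module field_ring N"
  shows tensor_rels_add_left: "\<lbrakk>x \<in> carrier M; x' \<in> carrier M; y \<in> carrier N\<rbrakk> \<Longrightarrow>
      (\<lambda>r. delta (x \<oplus>\<^bsub>M\<^esub> x', y) r - (delta (x, y) r + delta (x', y) r)) \<in> tensor_rels M N"
    and tensor_rels_smult_left: "\<lbrakk>x \<in> carrier M; y \<in> carrier N\<rbrakk> \<Longrightarrow>
      (\<lambda>r. delta (a \<odot>\<^bsub>M\<^esub> x, y) r - a * delta (x, y) r) \<in> tensor_rels M N"
    and tensor_rels_add_right: "\<lbrakk>x \<in> carrier M; y \<in> carrier N; y' \<in> carrier N\<rbrakk> \<Longrightarrow>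
      (\<lambda>r. delta (x, y \<oplus>\<^bsub>N\<^esub> y') r - (delta (x, y) r + delta (x, y') r)) \<in> tensor_rels M N"
    and tensor_rels_smult_right: "\<lbrakk>x \<in> carrier M; y \<in> carrier N\<rbrakk> \<Longrightarrow>
      (\<lambda>r. delta (x, a \<odot>\<^bsub>N\<^esub> y) r - a * delta (x, y) r) \<in> tensor_rels M N"
proof -
  note gens = subspace_span(2)[OF module_monoid_algebra tensor_rels_gens_subset[OF M N]]
  have d: "(\<lambda>x. delta (x, y)) \<in> carrier M \<rightarrow> carrier (monoid_algebra (M \<times>\<times> N) :: ('k, _) module)"
    if "y \<in> carrier N" for y
    using that by (auto simp: delta_mem_monoid_algebra)
  have d': "(\<lambda>y. delta (x, y)) \<in> carrier N \<rightarrow> carrier (monoid_algebra (M \<times>\<times> N) :: ('k, _) module)"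
    if "x \<in> carrier M" for x
    using that by (auto simp: delta_mem_monoid_algebra)
  have left: "{\<lambda>r. delta (u \<oplus>\<^bsub>M\<^esub> v, y) r - (delta (u, y) r + delta (v, y) r) | u v. u \<in> carrier M \<and> v \<in> carrier M} \<union>
      {\<lambda>r. delta (a \<odot>\<^bsub>M\<^esub> u, y) r - a * delta (u, y) r | a u. u \<in> carrier M} \<subseteq> tensor_rels M N"
    if "y \<in> carrier N" for y
    using gens that unfolding linear_rels_monoid_algebra[OF M d[OF that], symmetric] tensor_rels_def Let_def
    by blast
  have right: "{\<lambda>r. delta (x, u \<oplus>\<^bsub>N\<^esub> v) r - (delta (x, u) r + delta (x, v) r) | u v. u \<in> carrier N \<and> v \<in> carrier N} \<union>
      {\<lambda>r. delta (x, a \<odot>\<^bsub>N\<^esub> u) r - a * delta (x, u) r | a u. u \<in> carrier N} \<subseteq> tensor_rels M N"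
    if "x \<in> carrier M" for x
    using gens that unfolding linear_rels_monoid_algebra[OF N d'[OF that], symmetric] tensor_rels_def Let_def
    by blast
  show "\<lbrakk>x \<in> carrier M; x' \<in> carrier M; y \<in> carrier N\<rbrakk> \<Longrightarrow>
      (\<lambda>r. delta (x \<oplus>\<^bsub>M\<^esub> x', y) r - (delta (x, y) r + delta (x', y) r)) \<in> tensor_rels M N"
    by (rule subsetD[OF left]) blast+
  show "\<lbrakk>x \<in> carrier M; y \<in> carrier N\<rbrakk> \<Longrightarrow>
      (\<lambda>r. delta (a \<odot>\<^bsub>M\<^esub> x, y) r - a * delta (x, y) r) \<in> tensor_rels M N"
    by (rule subsetD[OF left]) blast+
  show "\<lbrakk>x \<in> carrier M; y \<in> carrier N; y' \<in> carrier N\<rbrakk> \<Longrightarrow>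
      (\<lambda>r. delta (x, y \<oplus>\<^bsub>N\<^esub> y') r - (delta (x, y) r + delta (x, y') r)) \<in> tensor_rels M N"
    by (rule subsetD[OF right]) blast+
  show "\<lbrakk>x \<in> carrier M; y \<in> carrier N\<rbrakk> \<Longrightarrow>
      (\<lambda>r. delta (x, a \<odot>\<^bsub>N\<^esub> y) r - a * delta (x, y) r) \<in> tensor_rels M N"
    by (rule subsetD[OF right]) blast+
qed

text \<open>The universal property of the tensor product in the form of a test on generators. In its
  applications H is the preimage of the relations of another tensor product under a linear
  map.\<close>

lemma tensor_rels_minimal:
  fixes M :: "('k::field, 'a) module" and N :: "('k, 'b) module"
  assumes M: "Module.module field_ring M" and N: "Module.module field_ring N"
    and H: "submodule H field_ring (monoid_algebra (M \<times>\<times> N))"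
    and "\<And>x x' y. \<lbrakk>x \<in> carrier M; x' \<in> carrier M; y \<in> carrier N\<rbrakk> \<Longrightarrow>
      (\<lambda>r. delta (x \<oplus>\<^bsub>M\<^esub> x', y) r - (delta (x, y) r + delta (x', y) r)) \<in> H"
    and "\<And>a x y. \<lbrakk>x \<in> carrier M; y \<in> carrier N\<rbrakk> \<Longrightarrow>
      (\<lambda>r. delta (a \<odot>\<^bsub>M\<^esub> x, y) r - a * delta (x, y) r) \<in> H"
    and "\<And>x y y'. \<lbrakk>x \<in> carrier M; y \<in> carrier N; y' \<in> carrier N\<rbrakk> \<Longrightarrow>
      (\<lambda>r. delta (x, y \<oplus>\<^bsub>N\<^esub> y') r - (delta (x, y) r + delta (x, y') r)) \<in> H"
    and "\<And>a x y. \<lbrakk>x \<in> carrier M; y \<in> carrier N\<rbrakk> \<Longrightarrow>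
      (\<lambda>r. delta (x, a \<odot>\<^bsub>N\<^esub> y) r - a * delta (x, y) r) \<in> H"
  shows "tensor_rels M N \<subseteq> H"
  unfolding tensor_rels_def Let_def
proof (intro subspace_span_minimal H Un_least UN_least)
  have d: "(\<lambda>x. delta (x, y)) \<in> carrier M \<rightarrow> carrier (monoid_algebra (M \<times>\<times> N) :: ('k, _) module)"
    if "y \<in> carrier N" for y
    using that by (auto simp: delta_mem_monoid_algebra)
  have d': "(\<lambda>y. delta (x, y)) \<in> carrier N \<rightarrow> carrier (monoid_algebra (M \<times>\<times> N) :: ('k, _) module)"
    if "x \<in> carrier M" for x
    using that by (auto simp: delta_mem_monoid_algebra)
  show "linear_rels (monoid_algebra (M \<times>\<times> N)) M (\<lambda>x. delta (x, y)) \<subseteq> H" if "y \<in> carrier N" for y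
    using that assms(4,5) unfolding linear_rels_monoid_algebra[OF M d[OF that]] by blast
  show "linear_rels (monoid_algebra (M \<times>\<times> N)) N (\<lambda>y. delta (x, y)) \<subseteq> H" if "x \<in> carrier M" for x
    using that assms(6,7) unfolding linear_rels_monoid_algebra[OF N d'[OF that]] by blast
qed

lemma module_tensor:
  assumes "Module.module field_ring M" "Module.module field_ring N"
  shows "Module.module field_ring (tensor M N)"
  unfolding tensor_def by (intro module_quotient module_monoid_algebra submodule_tensor_rels assms)

lemma tens_closed:
  assumes "x \<in> carrier M" "y \<in> carrier N"
  shows "tens M N x y \<in> carrier (tensor M N)"
  unfolding tensor_def tens_def quotient_simps carrier_quotient
  using assms by (intro imageI) (simp add: delta_mem_monoid_algebra)

lemma tensor_cases:
  assumes "t \<in> carrier (tensor M N)"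
  obtains f where "f \<in> carrier (monoid_algebra (M \<times>\<times> N))"
    "t = tensor_rels M N +>\<^bsub>monoid_algebra (M \<times>\<times> N)\<^esub> f"
  using assms unfolding tensor_def quotient_simps carrier_quotient by blast

section \<open>Tensor products of representations\<close>

abbreviation act_pair :: "('a \<Rightarrow> 'x \<Rightarrow> 'x) \<Rightarrow> ('b \<Rightarrow> 's \<Rightarrow> 's) \<Rightarrow> 'a \<times> 'b \<Rightarrow> 'x \<times> 's \<Rightarrow> 'x \<times> 's"
  where "act_pair \<pi> \<sigma> \<equiv> \<lambda>(a, \<eta>) (x, s). (\<pi> a x, \<sigma> \<eta> s)"

text \<open>The abstract situation behind the action of \<open>dam_cliff D\<close> on
  \<open>tensor V S\<close>. Below, F and G are the formal sums of pairs, I and R their bilinearity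
  relations, L the action on formal sums, and T the action it induces on classes.\<close>

locale tensor_of_reps =
  fixes M :: "('k::field, 'a) module" and N :: "('k, 'b) module"
    and V :: "('k, 'x) module" and S :: "('k, 's) module"
    and \<pi> :: "'a \<Rightarrow> 'x \<Rightarrow> 'x" and \<sigma> :: "'b \<Rightarrow> 's \<Rightarrow> 's"
  assumes M: "Module.module field_ring M" and N: "Module.module field_ring N"
    and M_mult: "monoid.mult M \<in> carrier M \<rightarrow> carrier M \<rightarrow> carrier M"
    and N_mult: "monoid.mult N \<in> carrier N \<rightarrow> carrier N \<rightarrow> carrier N"
    and \<pi>: "algebra_rep M \<pi> V" and \<sigma>: "algebra_rep N \<sigma> S"
begin

abbreviation "F \<equiv> monoid_algebra (M \<times>\<times> N) :: ('k, _) module"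
abbreviation "G \<equiv> monoid_algebra (V \<times>\<times> S) :: ('k, _) module"
abbreviation "I \<equiv> tensor_rels M N"
abbreviation "R \<equiv> tensor_rels V S"
abbreviation "L \<equiv> bilinear_ext (act_pair \<pi> \<sigma>) :: ('a \<times> 'b \<Rightarrow> 'k) \<Rightarrow> _"
abbreviation "T \<equiv> tensor_rep V S \<pi> \<sigma>"

lemma V: "Module.module field_ring V" and S: "Module.module field_ring S"
  using \<pi> \<sigma> by (auto simp: algebra_rep_def)

lemmas F_module = module_monoid_algebra[of "M \<times>\<times> N"]
lemmas G_module = module_monoid_algebra[of "V \<times>\<times> S"]
lemmas I_submodule = submodule_tensor_rels[OF M N]
lemmas R_submodule = submodule_tensor_rels[OF V S]

lemma R_add: "f \<in> R \<Longrightarrow> g \<in> R \<Longrightarrow> (\<lambda>x. f x + g x) \<in> R"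
  using submodule_add[OF R_submodule] by simp

lemma R_smult: "f \<in> R \<Longrightarrow> (\<lambda>x. a * f x) \<in> R"
  using submodule_smult[OF R_submodule] by simp

lemma R_zero: "(\<lambda>_. 0) \<in> R"
  using submodule_zero[OF R_submodule] by simp

lemma R_subset: "R \<subseteq> carrier G"
  by (rule submodule_subset[OF R_submodule])

lemma I_subset: "I \<subseteq> carrier F"
  by (rule submodule_subset[OF I_submodule])

lemma act_pair_closed:
  "p \<in> carrier (M \<times>\<times> N) \<Longrightarrow> q \<in> carrier (V \<times>\<times> S) \<Longrightarrow> act_pair \<pi> \<sigma> p q \<in> carrier (V \<times>\<times> S)"
  using \<pi> \<sigma> by (auto simp: algebra_rep_def)

lemma L_closed: "f \<in> carrier F \<Longrightarrow> g \<in> carrier G \<Longrightarrow> L f g \<in> carrier G"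
  by (rule bilinear_ext_mem_monoid_algebra) (assumption | rule act_pair_closed)+

lemma L_add_left:
  "\<lbrakk>f \<in> carrier F; f' \<in> carrier F; g \<in> carrier G\<rbrakk> \<Longrightarrow> L (\<lambda>x. f x + f' x) g = (\<lambda>r. L f g r + L f' g r)"
  by (simp add: bilinear_ext_add_left mem_monoid_algebra)

lemma L_add_right:
  "\<lbrakk>f \<in> carrier F; g \<in> carrier G; g' \<in> carrier G\<rbrakk> \<Longrightarrow> L f (\<lambda>x. g x + g' x) = (\<lambda>r. L f g r + L f g' r)"
  by (simp add: bilinear_ext_add_right mem_monoid_algebra)

lemma L_diff_left:
  "\<lbrakk>f \<in> carrier F; f' \<in> carrier F; g \<in> carrier G\<rbrakk> \<Longrightarrow> L (\<lambda>x. f x - f' x) g = (\<lambda>r. L f g r - L f' g r)"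
  using L_add_left[OF _ smult_mem_monoid_algebra, of f f' g "-1"]
    bilinear_ext_smult_left[of "act_pair \<pi> \<sigma>" "-1" f' g] by simp

lemma L_diff_right:
  "\<lbrakk>f \<in> carrier F; g \<in> carrier G; g' \<in> carrier G\<rbrakk> \<Longrightarrow> L f (\<lambda>x. g x - g' x) = (\<lambda>r. L f g r - L f g' r)"
  using L_add_right[OF _ _ smult_mem_monoid_algebra, of f g g' "-1"]
    bilinear_ext_smult_right[of "act_pair \<pi> \<sigma>" f "-1" g'] by simp

lemmas delta_simps = delta_mem_monoid_algebra bilinear_ext_delta bilinear_ext_smult_left bilinear_ext_smult_right

text \<open>A single pair (a, b) acts through the linear maps \<pi> a and \<sigma> b, so it sends
  each bilinearity relation to a bilinearity relation of the same kind. General f follows by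
  linearity in f.\<close>

lemma L_rels_right:
  assumes f: "f \<in> carrier F" and r: "r \<in> R"
  shows "L f r \<in> R"
proof -
  have *: "L (delta p) r \<in> R" if "p \<in> carrier (M \<times>\<times> N)" "r \<in> R" for p r
  proof -
    obtain a b where p: "p = (a, b)" "a \<in> carrier M" "b \<in> carrier N" using \<open>p \<in> _\<close> by auto
    \<comment> \<open>The preimage of R under the action of p is a subspace, so it contains R as
      soon as it contains the four kinds of generators.\<close>
    let ?H = "{r \<in> carrier G. L (delta p) r \<in> R}"
    have dp: "delta p \<in> carrier F" using p by (simp add: delta_mem_monoid_algebra)
    interpret V: module field_ring V by (rule V)
    interpret S: module field_ring S by (rule S)
    have \<pi>a: "\<pi> a x \<in> carrier V" "\<pi> a (x \<oplus>\<^bsub>V\<^esub> x') = \<pi> a x \<oplus>\<^bsub>V\<^esub> \<pi> a x'" "\<pi> a (k \<odot>\<^bsub>V\<^esub> x) = k \<odot>\<^bsub>V\<^esub> \<pi> a x"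
      if "x \<in> carrier V" "x' \<in> carrier V" for x x' k
      using that \<pi> p unfolding algebra_rep_def by auto
    have \<sigma>b: "\<sigma> b x \<in> carrier S" "\<sigma> b (x \<oplus>\<^bsub>S\<^esub> x') = \<sigma> b x \<oplus>\<^bsub>S\<^esub> \<sigma> b x'" "\<sigma> b (k \<odot>\<^bsub>S\<^esub> x) = k \<odot>\<^bsub>S\<^esub> \<sigma> b x"
      if "x \<in> carrier S" "x' \<in> carrier S" for x x' k
      using that \<sigma> p unfolding algebra_rep_def by auto
    have "R \<subseteq> ?H"
    proof (rule tensor_rels_minimal[OF V S])
      show "submodule ?H field_ring G"
        by (rule submodule_field_ringI[OF G_module])
          (auto simp: zero_mem_monoid_algebra add_mem_monoid_algebra smult_mem_monoid_algebra
            L_add_right dp R_zero R_add R_smult bilinear_ext_smult_right)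
    next
      fix x x' y assume xy: "x \<in> carrier V" "x' \<in> carrier V" "y \<in> carrier S"
      show "(\<lambda>r. delta (x \<oplus>\<^bsub>V\<^esub> x', y) r - (delta (x, y) r + delta (x', y) r)) \<in> ?H"
        using xy p dp tensor_rels_add_left[OF V S, of "\<pi> a x" "\<pi> a x'" "\<sigma> b y"]
        by (simp add: minus_mem_monoid_algebra add_mem_monoid_algebra delta_simps
            L_diff_right L_add_right \<pi>a \<sigma>b)
    next
      fix k x y assume xy: "x \<in> carrier V" "y \<in> carrier S"
      show "(\<lambda>r. delta (k \<odot>\<^bsub>V\<^esub> x, y) r - k * delta (x, y) r) \<in> ?H"
        using xy p dp tensor_rels_smult_left[OF V S, of "\<pi> a x" "\<sigma> b y" k]
        by (simp add: minus_mem_monoid_algebra smult_mem_monoid_algebra delta_simps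
            L_diff_right \<pi>a \<sigma>b)
    next
      fix x y y' assume xy: "x \<in> carrier V" "y \<in> carrier S" "y' \<in> carrier S"
      show "(\<lambda>r. delta (x, y \<oplus>\<^bsub>S\<^esub> y') r - (delta (x, y) r + delta (x, y') r)) \<in> ?H"
        using xy p dp tensor_rels_add_right[OF V S, of "\<pi> a x" "\<sigma> b y" "\<sigma> b y'"]
        by (simp add: minus_mem_monoid_algebra add_mem_monoid_algebra delta_simps
            L_diff_right L_add_right \<pi>a \<sigma>b)
    next
      fix k x y assume xy: "x \<in> carrier V" "y \<in> carrier S"
      show "(\<lambda>r. delta (x, k \<odot>\<^bsub>S\<^esub> y) r - k * delta (x, y) r) \<in> ?H"
        using xy p dp tensor_rels_smult_right[OF V S, of "\<pi> a x" "\<sigma> b y" k]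
        by (simp add: minus_mem_monoid_algebra smult_mem_monoid_algebra delta_simps
            L_diff_right \<pi>a \<sigma>b)
    qed
    with \<open>r \<in> R\<close> show ?thesis by blast
  qed
  have rG: "r \<in> carrier G" using r R_subset by blast
  show ?thesis
    using f
  proof (induction f rule: monoid_algebra_induct)
    case zero
    show ?case by (simp add: R_zero)
  next
    case (add f k p)
    then show ?case
      using * r rG by (simp add: L_add_left smult_mem_monoid_algebra delta_simps R_add R_smult
          bilinear_ext_smult_left[of _ k "delta p"])
  qed
qed

text \<open>The mirror image: for a fixed pair (x, s) of vectors, \<pi> and \<sigma> are linear in
  the algebra element, so relations between pairs of algebra elements become relations between pairs
  of vectors.\<close>

lemma L_rels_left:
  assumes i: "i \<in> I" and g: "g \<in> carrier G"
  shows "L i g \<in> R"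
proof -
  have *: "L i (delta p) \<in> R" if "p \<in> carrier (V \<times>\<times> S)" "i \<in> I" for p i
  proof -
    obtain a b where p: "p = (a, b)" "a \<in> carrier V" "b \<in> carrier S" using \<open>p \<in> _\<close> by auto
    let ?H = "{i \<in> carrier F. L i (delta p) \<in> R}"
    have dp: "delta p \<in> carrier G" using p by (simp add: delta_mem_monoid_algebra)
    interpret M: module field_ring M by (rule M)
    interpret N: module field_ring N by (rule N)
    have \<pi>a: "\<pi> x a \<in> carrier V" "\<pi> (x \<oplus>\<^bsub>M\<^esub> x') a = \<pi> x a \<oplus>\<^bsub>V\<^esub> \<pi> x' a" "\<pi> (k \<odot>\<^bsub>M\<^esub> x) a = k \<odot>\<^bsub>V\<^esub> \<pi> x a"
      if "x \<in> carrier M" "x' \<in> carrier M" for x x' k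
      using that \<pi> p unfolding algebra_rep_def by auto
    have \<sigma>b: "\<sigma> x b \<in> carrier S" "\<sigma> (x \<oplus>\<^bsub>N\<^esub> x') b = \<sigma> x b \<oplus>\<^bsub>S\<^esub> \<sigma> x' b" "\<sigma> (k \<odot>\<^bsub>N\<^esub> x) b = k \<odot>\<^bsub>S\<^esub> \<sigma> x b"
      if "x \<in> carrier N" "x' \<in> carrier N" for x x' k
      using that \<sigma> p unfolding algebra_rep_def by auto
    have "I \<subseteq> ?H"
    proof (rule tensor_rels_minimal[OF M N])
      show "submodule ?H field_ring F"
        by (rule submodule_field_ringI[OF F_module])
          (auto simp: zero_mem_monoid_algebra add_mem_monoid_algebra smult_mem_monoid_algebra
            L_add_left dp R_zero R_add R_smult bilinear_ext_smult_left)
    next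
      fix x x' y assume xy: "x \<in> carrier M" "x' \<in> carrier M" "y \<in> carrier N"
      show "(\<lambda>r. delta (x \<oplus>\<^bsub>M\<^esub> x', y) r - (delta (x, y) r + delta (x', y) r)) \<in> ?H"
        using xy p dp tensor_rels_add_left[OF V S, of "\<pi> x a" "\<pi> x' a" "\<sigma> y b"]
        by (simp add: minus_mem_monoid_algebra add_mem_monoid_algebra delta_simps
            L_diff_left L_add_left \<pi>a \<sigma>b)
    next
      fix k x y assume xy: "x \<in> carrier M" "y \<in> carrier N"
      show "(\<lambda>r. delta (k \<odot>\<^bsub>M\<^esub> x, y) r - k * delta (x, y) r) \<in> ?H"
        using xy p dp tensor_rels_smult_left[OF V S, of "\<pi> x a" "\<sigma> y b" k]
        by (simp add: minus_mem_monoid_algebra smult_mem_monoid_algebra delta_simps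
            L_diff_left \<pi>a \<sigma>b)
    next
      fix x y y' assume xy: "x \<in> carrier M" "y \<in> carrier N" "y' \<in> carrier N"
      show "(\<lambda>r. delta (x, y \<oplus>\<^bsub>N\<^esub> y') r - (delta (x, y) r + delta (x, y') r)) \<in> ?H"
        using xy p dp tensor_rels_add_right[OF V S, of "\<pi> x a" "\<sigma> y b" "\<sigma> y' b"]
        by (simp add: minus_mem_monoid_algebra add_mem_monoid_algebra delta_simps
            L_diff_left L_add_left \<pi>a \<sigma>b)
    next
      fix k x y assume xy: "x \<in> carrier M" "y \<in> carrier N"
      show "(\<lambda>r. delta (x, k \<odot>\<^bsub>N\<^esub> y) r - k * delta (x, y) r) \<in> ?H"
        using xy p dp tensor_rels_smult_right[OF V S, of "\<pi> x a" "\<sigma> y b" k]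
        by (simp add: minus_mem_monoid_algebra smult_mem_monoid_algebra delta_simps
            L_diff_left \<pi>a \<sigma>b)
    qed
    with \<open>i \<in> I\<close> show ?thesis by blast
  qed
  have iF: "i \<in> carrier F" using i I_subset by blast
  show ?thesis
    using g
  proof (induction g rule: monoid_algebra_induct)
    case zero
    show ?case by (simp add: R_zero)
  next
    case (add g k p)
    then show ?case
      using * i iF by (simp add: L_add_right smult_mem_monoid_algebra delta_simps R_add R_smult
          bilinear_ext_smult_right[of _ _ k "delta p"])
  qed
qed

text \<open>Multiplicativity of \<pi> and \<sigma> is an associativity law mixing the product of
  pairs with the action on pairs. It holds exactly for formal sums, before any classes are
  taken.\<close>

lemma L_mult:
  assumes "f \<in> carrier F" "f' \<in> carrier F" "g \<in> carrier G"
  shows "L (f \<otimes>\<^bsub>F\<^esub> f') g = L f (L f' g)"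
  unfolding monoid_algebra_simps
proof (rule bilinear_ext_assoc)
  fix p q s assume "p \<in> supp f" "q \<in> supp f'" "s \<in> supp g"
  then have "p \<in> carrier (M \<times>\<times> N)" "q \<in> carrier (M \<times>\<times> N)" "s \<in> carrier (V \<times>\<times> S)"
    using assms by (auto simp: mem_monoid_algebra)
  then show "act_pair \<pi> \<sigma> (p \<otimes>\<^bsub>M \<times>\<times> N\<^esub> q) s = act_pair \<pi> \<sigma> p (act_pair \<pi> \<sigma> q s)"
    using \<pi> \<sigma> by (auto simp: algebra_rep_def)
qed (use assms in \<open>auto simp: mem_monoid_algebra\<close>)

abbreviation "A \<equiv> tensor M N"
abbreviation "W \<equiv> tensor V S"

lemma A_module: "Module.module field_ring A" and W_module: "Module.module field_ring W"
  by (rule module_tensor[OF M N], rule module_tensor[OF V S])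

text \<open>With products read as L, f' g' - f g = (f' - f) g' + f (g' - g), and both summands lie
  in R by \<open>L_rels_left\<close> and \<open>L_rels_right\<close>. Hence the union defining
  \<open>tensor_rep\<close> is one coset and any representatives may be used.\<close>

lemma T_coset:
  assumes f: "f \<in> carrier F" and g: "g \<in> carrier G"
  shows "T (I +>\<^bsub>F\<^esub> f) (R +>\<^bsub>G\<^esub> g) = R +>\<^bsub>G\<^esub> L f g"
proof -
  have "R +>\<^bsub>G\<^esub> L f' g' = R +>\<^bsub>G\<^esub> L f g" if f': "f' \<in> I +>\<^bsub>F\<^esub> f" and g': "g' \<in> R +>\<^bsub>G\<^esub> g" for f' g'
  proof (rule coset_eqI[OF G_module R_submodule])
    have f'F: "f' \<in> carrier F" and i: "(\<lambda>x. f' x - f x) \<in> I"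
      using f' f by (auto simp: mem_coset_iff[OF F_module I_submodule f] monoid_algebra_minus)
    have g'G: "g' \<in> carrier G" and r: "(\<lambda>x. g' x - g x) \<in> R"
      using g' g by (auto simp: mem_coset_iff[OF G_module R_submodule g] monoid_algebra_minus)
    show closed: "L f' g' \<in> carrier G" "L f g \<in> carrier G"
      using f g f'F g'G by (simp_all add: L_closed)
    have "L (\<lambda>x. f' x - f x) g' \<in> R" "L f (\<lambda>x. g' x - g x) \<in> R"
      using i r g'G f by (simp_all add: L_rels_left L_rels_right)
    from R_add[OF this] have "(\<lambda>x. L f' g' x - L f g x) \<in> R"
      using f g f'F g'G by (simp add: L_diff_left L_diff_right)
    then show "L f' g' \<ominus>\<^bsub>G\<^esub> L f g \<in> R"
      using closed by (simp add: monoid_algebra_minus)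
  qed
  then show ?thesis
    using coset_self[OF F_module I_submodule f] coset_self[OF G_module R_submodule g]
    unfolding tensor_rep_def by blast
qed

section \<open>Linearity and composition of the operators on the tensor product of the
  modules\<close>

lemma coset_simps:
  "\<lbrakk>f \<in> carrier F; f' \<in> carrier F\<rbrakk> \<Longrightarrow> (I +>\<^bsub>F\<^esub> f) \<oplus>\<^bsub>A\<^esub> (I +>\<^bsub>F\<^esub> f') = I +>\<^bsub>F\<^esub> (\<lambda>x. f x + f' x)"
  "f \<in> carrier F \<Longrightarrow> k \<odot>\<^bsub>A\<^esub> (I +>\<^bsub>F\<^esub> f) = I +>\<^bsub>F\<^esub> (\<lambda>x. k * f x)"
  "\<lbrakk>g \<in> carrier G; g' \<in> carrier G\<rbrakk> \<Longrightarrow> (R +>\<^bsub>G\<^esub> g) \<oplus>\<^bsub>W\<^esub> (R +>\<^bsub>G\<^esub> g') = R +>\<^bsub>G\<^esub> (\<lambda>x. g x + g' x)"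
  "g \<in> carrier G \<Longrightarrow> k \<odot>\<^bsub>W\<^esub> (R +>\<^bsub>G\<^esub> g) = R +>\<^bsub>G\<^esub> (\<lambda>x. k * g x)"
  using coset_add[OF F_module I_submodule] coset_smult[OF F_module I_submodule]
    coset_add[OF G_module R_submodule] coset_smult[OF G_module R_submodule]
  by (simp_all add: tensor_def)

lemmas rep_simps = T_coset coset_simps add_mem_monoid_algebra smult_mem_monoid_algebra L_closed
  L_add_left L_add_right bilinear_ext_smult_left bilinear_ext_smult_right

lemma T_closed: "t \<in> carrier A \<Longrightarrow> u \<in> carrier W \<Longrightarrow> T t u \<in> carrier W"
  by (elim tensor_cases) (simp add: T_coset tensor_def carrier_quotient L_closed)

lemma T_add_left:
  "\<lbrakk>t \<in> carrier A; t' \<in> carrier A; u \<in> carrier W\<rbrakk> \<Longrightarrow> T (t \<oplus>\<^bsub>A\<^esub> t') u = T t u \<oplus>\<^bsub>W\<^esub> T t' u"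
  by (elim tensor_cases) (simp add: rep_simps)

lemma T_smult_left:
  "\<lbrakk>t \<in> carrier A; u \<in> carrier W\<rbrakk> \<Longrightarrow> T (k \<odot>\<^bsub>A\<^esub> t) u = k \<odot>\<^bsub>W\<^esub> T t u"
  by (elim tensor_cases) (simp add: rep_simps)

lemma T_add_right:
  "\<lbrakk>t \<in> carrier A; u \<in> carrier W; u' \<in> carrier W\<rbrakk> \<Longrightarrow> T t (u \<oplus>\<^bsub>W\<^esub> u') = T t u \<oplus>\<^bsub>W\<^esub> T t u'"
  by (elim tensor_cases) (simp add: rep_simps)

lemma T_smult_right:
  "\<lbrakk>t \<in> carrier A; u \<in> carrier W\<rbrakk> \<Longrightarrow> T t (k \<odot>\<^bsub>W\<^esub> u) = k \<odot>\<^bsub>W\<^esub> T t u"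
  by (elim tensor_cases) (simp add: rep_simps)

text \<open>
  The product of two cosets is only known to contain the product of representatives; that
  \<^const>\<open>tensor_rels\<close> is an ideal is not needed for this.
\<close>

lemma T_anticommutator:
  assumes t: "t \<in> carrier A" "r \<in> carrier A" "d \<in> carrier A" "a \<in> carrier A" and u: "u \<in> carrier W"
    and eq: "t = r \<oplus>\<^bsub>A\<^esub> (d \<otimes>\<^bsub>A\<^esub> a) \<oplus>\<^bsub>A\<^esub> (a \<otimes>\<^bsub>A\<^esub> d)"
  shows "T t u = T r u \<oplus>\<^bsub>W\<^esub> T d (T a u) \<oplus>\<^bsub>W\<^esub> T a (T d u)"
proof -
  obtain ft fr fd fa where f: "ft \<in> carrier F" "fr \<in> carrier F" "fd \<in> carrier F" "fa \<in> carrier F"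
    and teq: "t = I +>\<^bsub>F\<^esub> ft" "r = I +>\<^bsub>F\<^esub> fr" "d = I +>\<^bsub>F\<^esub> fd" "a = I +>\<^bsub>F\<^esub> fa"
    using t by (metis tensor_cases)
  obtain g where g: "g \<in> carrier G" "u = R +>\<^bsub>G\<^esub> g" using u by (rule tensor_cases)
  have closed: "f \<otimes>\<^bsub>F\<^esub> f' \<in> carrier F" if "f \<in> carrier F" "f' \<in> carrier F" for f f'
    unfolding monoid_algebra_simps
    by (rule bilinear_ext_mem_monoid_algebra[OF that]) (auto intro: M_mult[THEN funcset_mem, THEN funcset_mem] N_mult[THEN funcset_mem, THEN funcset_mem])
  have mult: "f \<otimes>\<^bsub>F\<^esub> f' \<in> (I +>\<^bsub>F\<^esub> f) \<otimes>\<^bsub>A\<^esub> (I +>\<^bsub>F\<^esub> f')" if "f \<in> carrier F" "f' \<in> carrier F" for f f'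
    unfolding tensor_def quotient_simps rcoset_mult_def
    by (intro UN_I[of f] UN_I[of f'] coset_self[OF F_module I_submodule] closed that)
  \<comment> \<open>This formal sum is a member of the coset t, being a sum of members of the three
    summands, and may therefore replace \<open>ft\<close> as representative of t.\<close>
  let ?e = "\<lambda>x. fr x + (fd \<otimes>\<^bsub>F\<^esub> fa) x + (fa \<otimes>\<^bsub>F\<^esub> fd) x"
  have "fr \<oplus>\<^bsub>F\<^esub> (fd \<otimes>\<^bsub>F\<^esub> fa) \<oplus>\<^bsub>F\<^esub> (fa \<otimes>\<^bsub>F\<^esub> fd) \<in> t"
    unfolding eq teq using mult[OF f(3,4)] mult[OF f(4,3)] coset_self[OF F_module I_submodule f(2)]
    unfolding tensor_def quotient_simps set_add_def' by blast
  then have e: "?e \<in> I +>\<^bsub>F\<^esub> ft" by (simp add: teq)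
  have eF: "?e \<in> carrier F" by (rule coset_cong(2)[OF F_module I_submodule f(1) e])
  have "T t u = R +>\<^bsub>G\<^esub> L ?e g"
    using T_coset[OF eF g(1)] coset_cong(1)[OF F_module I_submodule f(1) e] by (simp add: teq g(2))
  also have "L ?e g = (\<lambda>x. L fr g x + L fd (L fa g) x + L fa (L fd g) x)"
    using f g(1) closed[OF f(3,4)] closed[OF f(4,3)] L_mult[OF f(3,4) g(1)] L_mult[OF f(4,3) g(1)]
      L_add_left[OF add_mem_monoid_algebra[OF f(2) closed[OF f(3,4)]] closed[OF f(4,3)] g(1)]
      L_add_left[OF f(2) closed[OF f(3,4)] g(1)]
    by simp
  also have "R +>\<^bsub>G\<^esub> \<dots> = T r u \<oplus>\<^bsub>W\<^esub> T d (T a u) \<oplus>\<^bsub>W\<^esub> T a (T d u)"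
    using f g by (simp add: teq rep_simps)
  finally show ?thesis .
qed

text \<open>On a pair (x, s) the operator gives (k x, s), which differs from k times (x, s) by a
  generator of R; the equation thus holds only after passing to classes. This is how a central
  character acts on the whole tensor product.\<close>

lemma T_tens_scalar:
  assumes z: "z \<in> carrier M" "\<And>x. x \<in> carrier V \<Longrightarrow> \<pi> z x = k \<odot>\<^bsub>V\<^esub> x"
    and N_one: "\<one>\<^bsub>N\<^esub> \<in> carrier N" and u: "u \<in> carrier W"
  shows "T (tens M N z \<one>\<^bsub>N\<^esub>) u = k \<odot>\<^bsub>W\<^esub> u"
proof -
  obtain g where g: "g \<in> carrier G" "u = R +>\<^bsub>G\<^esub> g" using u by (rule tensor_cases)
  let ?z = "delta (z, \<one>\<^bsub>N\<^esub>) :: 'a \<times> 'b \<Rightarrow> 'k"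
  have zF: "?z \<in> carrier F" using z N_one by (simp add: delta_mem_monoid_algebra)
  have "(\<lambda>r. L ?z g r - k * g r) \<in> R"
    using g(1)
  proof (induction g rule: monoid_algebra_induct)
    case zero
    show ?case by (simp add: R_zero)
  next
    case (add g c p)
    obtain x s where p: "p = (x, s)" "x \<in> carrier V" "s \<in> carrier S" using add by auto
    have "\<sigma> \<one>\<^bsub>N\<^esub> s = s" using \<sigma> p by (simp add: algebra_rep_def)
    then have "(\<lambda>r. L ?z (delta p) r - k * delta p r) \<in> R"
      using p z tensor_rels_smult_left[OF V S p(2,3), of k] by (simp add: bilinear_ext_delta)
    from R_add[OF add(3) R_smult[OF this, of c]]
    show ?case
      using add zF by (simp add: L_add_right smult_mem_monoid_algebra delta_mem_monoid_algebra
          bilinear_ext_smult_right[of _ _ c "delta p"] algebra_simps)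
  qed
  then have "R +>\<^bsub>G\<^esub> L ?z g = R +>\<^bsub>G\<^esub> (\<lambda>r. k * g r)"
    using g zF by (intro coset_eqI[OF G_module R_submodule])
      (simp_all add: L_closed smult_mem_monoid_algebra monoid_algebra_minus)
  then show ?thesis
    using g zF by (simp add: tens_def rep_simps)
qed

lemma T_zero_left: "u \<in> carrier W \<Longrightarrow> T \<zero>\<^bsub>A\<^esub> u = \<zero>\<^bsub>W\<^esub>"
proof -
  interpret A: module field_ring A by (rule A_module)
  interpret W: module field_ring W by (rule W_module)
  assume u: "u \<in> carrier W"
  show ?thesis
    using T_smult_left[OF A.M.zero_closed u, of 0] A.smult_l_null[OF A.M.zero_closed]
      W.smult_l_null[OF T_closed[OF A.M.zero_closed u]] by simp
qed

lemma T_zero_right: "t \<in> carrier A \<Longrightarrow> T t \<zero>\<^bsub>W\<^esub> = \<zero>\<^bsub>W\<^esub>"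
proof -
  interpret W: module field_ring W by (rule W_module)
  assume t: "t \<in> carrier A"
  show ?thesis
    using T_smult_right[OF t W.M.zero_closed, of 0] W.smult_l_null[OF W.M.zero_closed]
      W.smult_l_null[OF T_closed[OF t W.M.zero_closed]] by simp
qed

lemma T_finsum:
  assumes "finite X" "t \<in> X \<rightarrow> carrier A" and u: "u \<in> carrier W"
  shows "T (finsum A t X) u = (\<Oplus>\<^bsub>W\<^esub>i\<in>X. T (t i) u)"
  using assms(1,2)
proof (induction X rule: finite_induct)
  interpret A: module field_ring A by (rule A_module)
  interpret W: module field_ring W by (rule W_module)
  case empty
  show ?case by (simp add: T_zero_left[OF u])
next
  interpret A: module field_ring A by (rule A_module)
  interpret W: module field_ring W by (rule W_module)
  case (insert i X)
  have "finsum A t (insert i X) = t i \<oplus>\<^bsub>A\<^esub> finsum A t X"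
    using insert by (intro A.M.finsum_insert) auto
  moreover have "(\<Oplus>\<^bsub>W\<^esub>j\<in>insert i X. T (t j) u) = T (t i) u \<oplus>\<^bsub>W\<^esub> (\<Oplus>\<^bsub>W\<^esub>j\<in>X. T (t j) u)"
    using insert by (intro W.M.finsum_insert) (auto intro: T_closed[OF _ u])
  moreover have "finsum A t X \<in> carrier A" using insert by (intro A.M.finsum_closed) auto
  ultimately show ?case using insert by (simp add: T_add_left u)
qed

lemma submodule_T_ker:
  assumes "t \<in> carrier A"
  shows "submodule {u \<in> carrier W. T t u = \<zero>\<^bsub>W\<^esub>} field_ring W"
proof -
  interpret W: module field_ring W by (rule W_module)
  have "k \<odot>\<^bsub>W\<^esub> x \<in> carrier W" "k \<odot>\<^bsub>W\<^esub> \<zero>\<^bsub>W\<^esub> = \<zero>\<^bsub>W\<^esub>" if "x \<in> carrier W" for k x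
    using that W.smult_closed[of k x] W.smult_r_null[of k] by simp_all
  then show ?thesis
    using assms by (intro submodule_field_ringI[OF W_module])
      (auto simp: T_zero_right T_add_right T_smult_right)
qed

lemma submodule_T_image:
  assumes t: "t \<in> carrier A"
  shows "submodule (T t ` carrier W) field_ring W"
proof (rule submodule_field_ringI[OF W_module])
  interpret W: module field_ring W by (rule W_module)
  show "T t ` carrier W \<subseteq> carrier W" using t by (auto simp: T_closed)
  show "\<zero>\<^bsub>W\<^esub> \<in> T t ` carrier W" using T_zero_right[OF t] W.M.zero_closed by (metis imageI)
  fix x assume "x \<in> T t ` carrier W"
  then obtain u where u: "u \<in> carrier W" "x = T t u" by blast
  show "k \<odot>\<^bsub>W\<^esub> x \<in> T t ` carrier W" for k
    using u t W.smult_closed[of k u] by (auto simp flip: T_smult_right)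
  fix y assume "y \<in> T t ` carrier W"
  then obtain v where v: "v \<in> carrier W" "y = T t v" by blast
  show "x \<oplus>\<^bsub>W\<^esub> y \<in> T t ` carrier W"
    using u v t by (auto simp flip: T_add_right)
qed

end

section \<open>Intertwiners into a subquotient\<close>

lemma mat_mult_vec: "mat k *v w = k *s (w :: complex^'n)"
  by (simp add: vec_eq_iff mat_def matrix_vector_mult_def if_distrib[of "\<lambda>x. x * _"] cong: if_cong)

lemma matrix_rep_ext_mult_vec:
  fixes \<tau> :: "'g \<Rightarrow> complex^'n^'n"
  shows "matrix_rep_ext \<tau> f *v v = (\<Sum>g | f g \<noteq> 0. f g *s (\<tau> g *v v))"
proof -
  have "(mat k ** B) *v v = k *s (B *v v)" for k and B :: "complex^'n^'n"
    by (metis matrix_vector_mul_assoc mat_mult_vec)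
  moreover have "(\<Sum>g\<in>A. B g) *v v = (\<Sum>g\<in>A. B g *v v)" for A and B :: "'g \<Rightarrow> complex^'n^'n"
    by (induction A rule: infinite_finite_induct) (simp_all add: matrix_vector_mult_add_rdistrib)
  ultimately show ?thesis by (simp only: matrix_rep_ext_def)
qed

text \<open>Dirac cohomology in abstract form: K stands for the kernel, Y for the image, and
  \<open>P g\<close> for the operator of \<rho>(g) on representatives. Since \<Phi> v is itself a
  coset, the facts below are phrased for members u of \<Phi> v.\<close>

locale subquotient_intertwiner =
  fixes W :: "(complex, 'w) module" and K Y :: "'w set"
    and \<Gamma> :: "'g monoid" and \<tau> :: "'g \<Rightarrow> complex^'d^'d" and P :: "'g \<Rightarrow> 'w \<Rightarrow> 'w" and \<Phi>
  assumes W: "Module.module field_ring W" and K: "submodule K field_ring W"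
    and Y: "submodule Y field_ring W"
    and \<Phi>: "\<Phi> \<in> intertwiners \<Gamma> \<tau> (\<lambda>g U. \<Union>u\<in>U. (K \<inter> Y) +>\<^bsub>W\<^esub> P g u)
      (quotient (W\<lparr>carrier := K\<rparr>) (K \<inter> Y))"
begin

abbreviation "J \<equiv> K \<inter> Y"

lemma J: "submodule J field_ring W"
  using submodule_Inter[OF W, of "{K, Y}"] K Y by auto

text \<open>A coset depends on the addition alone, so cosets formed inside K can be treated as
  cosets in the full space W.\<close>

lemma coset_carrier_update: "J +>\<^bsub>W\<lparr>carrier := K\<rparr>\<^esub> x = J +>\<^bsub>W\<^esub> x"
  by (simp add: a_r_coset_def')

lemma \<Phi>_cases: obtains y where "y \<in> K" "\<Phi> v = J +>\<^bsub>W\<^esub> y"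
proof -
  have "\<Phi> v \<in> carrier (quotient (W\<lparr>carrier := K\<rparr>) J)" using \<Phi> by (simp add: intertwiners_def)
  then show ?thesis using that by (auto simp: carrier_quotient coset_carrier_update)
qed

lemma \<Phi>_coset:
  assumes "u \<in> \<Phi> v" shows "\<Phi> v = J +>\<^bsub>W\<^esub> u" "u \<in> K"
proof -
  obtain y where y: "y \<in> K" "\<Phi> v = J +>\<^bsub>W\<^esub> y" by (rule \<Phi>_cases)
  then have yW: "y \<in> carrier W" using submodule_subset[OF K] by blast
  show "\<Phi> v = J +>\<^bsub>W\<^esub> u" using coset_cong(1)[OF W J yW] assms y by simp
  show "u \<in> K" using assms y submodule_add[OF K] by (auto simp: a_r_coset_def')
qed

lemma \<Phi>_carrier: "u \<in> \<Phi> v \<Longrightarrow> u \<in> carrier W"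
  using \<Phi>_coset(2) submodule_subset[OF K] by blast

lemma \<Phi>_add:
  assumes "u \<in> \<Phi> v" "u' \<in> \<Phi> v'" shows "u \<oplus>\<^bsub>W\<^esub> u' \<in> \<Phi> (v + v')"
proof -
  have "\<Phi> (v + v') = \<Phi> v \<oplus>\<^bsub>quotient (W\<lparr>carrier := K\<rparr>) J\<^esub> \<Phi> v'" using \<Phi> by (simp add: intertwiners_def)
  with assms show ?thesis by (auto simp: set_add_def')
qed

lemma \<Phi>_smult:
  assumes "u \<in> \<Phi> v" shows "k \<odot>\<^bsub>W\<^esub> u \<in> \<Phi> (k *s v)"
proof -
  interpret module field_ring W by (rule W)
  have "\<Phi> (k *s v) = k \<odot>\<^bsub>quotient (W\<lparr>carrier := K\<rparr>) J\<^esub> \<Phi> v" using \<Phi> by (simp add: intertwiners_def)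
  moreover have "k \<odot>\<^bsub>W\<^esub> u \<in> J +>\<^bsub>W\<^esub> (k \<odot>\<^bsub>W\<^esub> u)"
    using assms by (intro coset_self[OF W J]) (simp add: \<Phi>_carrier)
  ultimately show ?thesis using assms by (auto simp: coset_carrier_update)
qed

text \<open>
  Intertwining forces \<^term>\<open>P g u\<close> to stay in \<^term>\<open>K\<close>, so \<^term>\<open>K\<close> need not be assumed to be invariant.
\<close>

lemma \<Phi>_group:
  assumes "u \<in> \<Phi> v" "g \<in> carrier \<Gamma>" "P g u \<in> carrier W" shows "P g u \<in> \<Phi> (\<tau> g *v v)"
proof -
  have "\<Phi> (\<tau> g *v v) = (\<Union>u\<in>\<Phi> v. J +>\<^bsub>W\<^esub> P g u)"
    using \<Phi> assms(2) by (simp add: intertwiners_def)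
  with coset_self[OF W J assms(3)] assms(1) show ?thesis by blast
qed

lemma \<Phi>_finsum:
  assumes "finite A" "A \<subseteq> carrier \<Gamma>" and u: "u \<in> \<Phi> v" and P: "\<And>g. g \<in> A \<Longrightarrow> P g u \<in> carrier W"
  shows "(\<Oplus>\<^bsub>W\<^esub>g\<in>A. f g \<odot>\<^bsub>W\<^esub> P g u) \<in> \<Phi> (\<Sum>g\<in>A. f g *s (\<tau> g *v v))"
  using assms(1,2) P
proof (induction A rule: finite_induct)
  case empty
  interpret module field_ring W by (rule W)
  \<comment> \<open>The empty sum is 0 times u, a member of \<Phi> 0.\<close>
  show ?case using \<Phi>_smult[OF u, of 0] \<Phi>_carrier[OF u] smult_l_null[of u] by simp
next
  case (insert g A)
  interpret module field_ring W by (rule W)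
  have "(\<Oplus>\<^bsub>W\<^esub>h\<in>insert g A. f h \<odot>\<^bsub>W\<^esub> P h u) =
      (f g \<odot>\<^bsub>W\<^esub> P g u) \<oplus>\<^bsub>W\<^esub> (\<Oplus>\<^bsub>W\<^esub>h\<in>A. f h \<odot>\<^bsub>W\<^esub> P h u)"
    using insert by (intro M.finsum_insert) auto
  then show ?case
    using insert by (auto intro!: \<Phi>_add \<Phi>_smult \<Phi>_group[OF u])
qed

lemma \<Phi>_zeroI:
  assumes "u \<in> J" "u \<in> \<Phi> v" shows "\<Phi> v = J"
proof -
  interpret abelian_subgroup J W by (rule abelian_subgroup_submodule[OF W J])
  show ?thesis using \<Phi>_coset(1)[OF assms(2)] assms(1) by (simp add: a_rcos_const)
qed

text \<open>In use k is the value of the central character, c the normalized character, and y the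
  contribution of the half of the anticommutator that lies in the image.\<close>

lemma scalar_eqI:
  assumes \<Phi>_nonzero: "\<Phi> \<noteq> (\<lambda>_. J)" and fin: "finite {g. f g \<noteq> 0}" "{g. f g \<noteq> 0} \<subseteq> carrier \<Gamma>"
    and P: "\<And>g u. g \<in> carrier \<Gamma> \<Longrightarrow> u \<in> carrier W \<Longrightarrow> P g u \<in> carrier W"
    and scalar: "matrix_rep_ext \<tau> f = mat c"
    and eq: "\<And>u. u \<in> K \<Longrightarrow>
      \<exists>y\<in>Y. k \<odot>\<^bsub>W\<^esub> u = (\<Oplus>\<^bsub>W\<^esub>g\<in>{g. f g \<noteq> 0}. f g \<odot>\<^bsub>W\<^esub> P g u) \<oplus>\<^bsub>W\<^esub> y"
  shows "k = c"
proof (rule ccontr)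
  assume "k \<noteq> c"
  interpret module field_ring W by (rule W)
  obtain v where v: "\<Phi> v \<noteq> J" using \<Phi>_nonzero by blast
  obtain u where u: "u \<in> \<Phi> v"
    using \<Phi>_cases[of v] submodule_subset[OF K] coset_self[OF W J] by (metis subsetD)
  note uW = \<Phi>_carrier[OF u]
  let ?w = "\<Oplus>\<^bsub>W\<^esub>g\<in>{g. f g \<noteq> 0}. f g \<odot>\<^bsub>W\<^esub> P g u"
  have "?w \<in> \<Phi> (matrix_rep_ext \<tau> f *v v)"
    unfolding matrix_rep_ext_mult_vec
    using fin P uW by (intro \<Phi>_finsum u) auto
  also have "matrix_rep_ext \<tau> f *v v = c *s v"
    by (simp only: scalar mat_mult_vec)
  finally have w: "?w \<in> \<Phi> (c *s v)" .
  \<comment> \<open>Both \<open>?w\<close> and c u represent \<Phi> (c v), so they differ by an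
    element of J.\<close>
  have "?w \<in> J +>\<^bsub>W\<^esub> (c \<odot>\<^bsub>W\<^esub> u)"
    using w \<Phi>_coset(1)[OF \<Phi>_smult[OF u, of c]] by simp
  then obtain x where x: "x \<in> J" "?w = x \<oplus>\<^bsub>W\<^esub> (c \<odot>\<^bsub>W\<^esub> u)" by (auto simp: a_r_coset_def')
  obtain j where j: "j \<in> Y" "k \<odot>\<^bsub>W\<^esub> u = ?w \<oplus>\<^bsub>W\<^esub> j"
    using eq[OF \<Phi>_coset(2)[OF u]] by blast
  have xW: "x \<in> carrier W" and jW: "j \<in> carrier W"
    using x(1) j(1) submodule_subset[OF Y] by blast+
  have "(k - c) \<odot>\<^bsub>W\<^esub> u = x \<oplus>\<^bsub>W\<^esub> j"
  proof -
    have "(x \<oplus>\<^bsub>W\<^esub> j) \<oplus>\<^bsub>W\<^esub> (c \<odot>\<^bsub>W\<^esub> u) = ((k - c) \<odot>\<^bsub>W\<^esub> u) \<oplus>\<^bsub>W\<^esub> (c \<odot>\<^bsub>W\<^esub> u)"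
      using j(2) x(2) xW jW uW smult_l_distr[of "k - c" c u] by (simp add: M.a_ac)
    then show ?thesis using xW jW uW M.add.right_cancel by simp
  qed
  then have "u = (1 / (k - c)) \<odot>\<^bsub>W\<^esub> (x \<oplus>\<^bsub>W\<^esub> j)"
    using \<open>k \<noteq> c\<close> uW smult_assoc1[of "1 / (k - c)" "k - c" u] smult_one[of u] by simp
  \<comment> \<open>The elements x and j give membership in Y; membership in K comes from u being a
    member of \<Phi> v.\<close>
  then have "u \<in> J"
    using \<Phi>_coset(2)[OF u] x(1) j(1) submodule_add[OF Y] submodule_smult[OF Y] by auto
  with u v \<Phi>_zeroI show False by blast
qed

end

section \<open>Schur's lemma for matrix representations\<close>

text \<open>The vector p(A) w, evaluated by Horner's rule on vectors, so that no powers of matrices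
  have to be formed.\<close>

definition poly_act :: "complex^'n^'n \<Rightarrow> complex poly \<Rightarrow> complex^'n \<Rightarrow> complex^'n"
  where "poly_act A p w = fold_coeffs (\<lambda>a x. a *s w + A *v x) p 0"

lemma poly_act_0 [simp]: "poly_act A 0 w = 0"
  by (simp add: poly_act_def)

text \<open>The exceptional case is \<open>pCons 0 0\<close>, which is the zero polynomial and has
  no coefficients to fold over; there both sides are zero.\<close>

lemma poly_act_pCons [simp]: "poly_act A (pCons a p) w = a *s w + A *v poly_act A p w"
  by (cases "p = 0"; cases "a = 0")
    (simp_all add: poly_act_def fold_coeffs_pCons_coeff_not_0_eq fold_coeffs_pCons_not_0_0_eq)

lemma poly_act_add: "poly_act A (p + q) w = poly_act A p w + poly_act A q w"
  by (induction p q rule: poly_induct2) (simp_all add: matrix_vector_right_distrib vec.scale_left_distrib)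

lemma poly_act_smult: "poly_act A (Polynomial.smult c p) w = c *s poly_act A p w"
  by (induction p) (simp_all add: vec.scale_right_distrib vector_scalar_commute)

lemma poly_act_monom: "poly_act A (Polynomial.monom c i) w = c *s (((*v) A ^^ i) w)"
  by (induction i) (simp_all add: monom_0 monom_Suc vector_scalar_commute)

lemma poly_act_sum: "poly_act A (sum p I) w = (\<Sum>i\<in>I. poly_act A (p i) w)"
  by (induction I rule: infinite_finite_induct) (simp_all add: poly_act_add)

text \<open>The n + 1 vectors w, A w, ..., A^n w in a space of dimension n are dependent, and the
  coefficients of a dependence form the polynomial. Dependence is a notion for sets, so a repetition
  A^i w = A^j w is treated separately, with the polynomial X^i - X^j.\<close>

lemma exists_annihilating_poly: "\<exists>p\<noteq>0. poly_act A p w = 0"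
proof -
  \<comment> \<open>Here \<open>'a\<close> is the inferred index type of A, so \<open>?n\<close> is
    the dimension; the range up to and including \<open>?n\<close> supplies one vector too
    many.\<close>
  let ?B = "\<lambda>i. ((*v) A ^^ i) w" and ?n = "CARD('a)"
  have act: "poly_act A (\<Sum>i\<le>?n. Polynomial.monom (a i) i) w = (\<Sum>i\<le>?n. a i *s ?B i)" for a
    by (simp add: poly_act_sum poly_act_monom)
  have coeff: "Polynomial.coeff (\<Sum>i\<le>?n. Polynomial.monom (a i) i) j = a j" if "j \<le> ?n" for a :: "nat \<Rightarrow> complex" and j
    using that by (simp add: coeff_sum)
  show ?thesis
  proof (cases "inj_on ?B {..?n}")
    case True
    have "vec.dependent (?B ` {..?n})"
      using vec.independent_card_le_dim[of "?B ` {..?n}" UNIV] card_image[OF True] by (auto simp: card_cart_basis vec_dim_card)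
    then obtain u where u: "\<exists>v\<in>?B ` {..?n}. u v \<noteq> 0" "(\<Sum>v\<in>?B ` {..?n}. u v *s v) = 0"
      by (auto simp: vec.dependent_finite)
    let ?p = "\<Sum>i\<le>?n. Polynomial.monom (u (?B i)) i"
    have "poly_act A ?p w = 0"
      unfolding act using u(2) by (simp add: sum.reindex[OF True])
    moreover obtain i where i: "i \<le> ?n" "u (?B i) \<noteq> 0" using u(1) by auto
    then have "Polynomial.coeff ?p i \<noteq> 0" by (subst coeff) auto
    then have "?p \<noteq> 0" by (metis coeff_0)
    ultimately show ?thesis by blast
  next
    case False
    then obtain i j where ij: "i \<noteq> j" "?B i = ?B j" by (auto simp: inj_on_def)
    let ?p = "Polynomial.monom 1 i + Polynomial.monom (-1) j :: complex poly"
    have "poly_act A ?p w = 0" using ij(2) by (simp add: poly_act_add poly_act_monom)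
    moreover have "Polynomial.coeff ?p i \<noteq> 0" using ij(1) by simp
    then have "?p \<noteq> 0" by (metis coeff_0)
    ultimately show ?thesis by blast
  qed
qed

text \<open>Descent on the degree of a polynomial that annihilates a vector w \<noteq> 0. It is not
  a nonzero constant, so it factors as (X - c) q with a complex root c, and (A - c) kills q(A)
  w.\<close>

lemma exists_eigenvector: "\<exists>c. \<exists>v\<noteq>0. A *v v = c *s v" for A :: "complex^'n^'n"
proof -
  have *: "\<exists>c. \<exists>v\<noteq>0. A *v v = c *s v" if "p \<noteq> 0" "poly_act A p w = 0" "w \<noteq> 0" for p w
    using that
  proof (induction "degree p" arbitrary: p rule: less_induct)
    case less
    show ?case
    proof (cases "degree p = 0")
      case True
      then obtain a where "p = [:a:]" by (rule degree_eq_zeroE)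
      with less show ?thesis by simp
    next
      case False
      then obtain c where "poly p c = 0"
        using fundamental_theorem_of_algebra[of p] by (auto simp: constant_degree)
      then obtain q where q: "p = [:-c, 1:] * q" by (auto simp: poly_eq_0_iff_dvd)
      have q0: "q \<noteq> 0" using q less.prems by auto
      have deg: "degree q < degree p" unfolding q using q0 by (subst degree_mult_eq) auto
      have "A *v poly_act A q w = c *s poly_act A q w"
      proof -
        have "p = Polynomial.smult (- c) q + pCons 0 q" by (simp add: q)
        then have "poly_act A p w = A *v poly_act A q w - c *s poly_act A q w"
          by (simp only: poly_act_add poly_act_smult poly_act_pCons) simp
        with less.prems(2) show ?thesis by simp
      qed
      \<comment> \<open>Either q(A) w is nonzero and an eigenvector for c, or q annihilates w and
        has smaller degree.\<close>
      then show ?thesis using less.hyps[OF deg q0] less.prems(3) by metis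
    qed
  qed
  obtain w :: "complex^'n" where "w \<noteq> 0"
    by (metis zero_neq_one)
  with * exists_annihilating_poly[of A w] show ?thesis by blast
qed

text \<open>An eigenspace of A is nonzero and, because A commutes with every \<tau> g, invariant;
  irreducibility makes it the whole space.\<close>

lemma schur:
  fixes A :: "complex^'d^'d"
  assumes \<tau>: "irreducible_matrix_rep \<Gamma> \<tau>"
    and comm: "\<And>g v. g \<in> carrier \<Gamma> \<Longrightarrow> A *v (\<tau> g *v v) = \<tau> g *v (A *v v)"
  obtains c where "A = mat c"
proof -
  obtain c v where v: "v \<noteq> 0" "A *v v = c *s v" using exists_eigenvector[of A] by blast
  let ?U = "{v. A *v v = c *s v}"
  have "vec.subspace ?U"
    by (auto simp: vec.subspace_def matrix_vector_right_distrib vec.scale_right_distrib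
        vector_scalar_commute vec.scale_left_commute)
  moreover have "\<forall>g\<in>carrier \<Gamma>. \<forall>u\<in>?U. \<tau> g *v u \<in> ?U"
    by (simp add: comm vector_scalar_commute)
  ultimately have "?U = {0} \<or> ?U = UNIV"
    using \<tau> by (auto simp: irreducible_matrix_rep_def)
  then have "A *v x = mat c *v x" for x
    using v by (auto simp: mat_mult_vec)
  then have "A = mat c" by (simp add: matrix_eq)
  then show thesis by (rule that)
qed

section \<open>The group algebra in a matrix representation and the scalars of its centre\<close>

lemma matrix_rep_ext_mult:
  fixes \<tau> :: "'g \<Rightarrow> complex^'d^'d"
  assumes \<tau>: "matrix_rep \<Gamma> \<tau>"
    and f: "f \<in> carrier (monoid_algebra \<Gamma>)" and h: "h \<in> carrier (monoid_algebra \<Gamma>)"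
  shows "matrix_rep_ext \<tau> (f \<otimes>\<^bsub>monoid_algebra \<Gamma>\<^esub> h) *v v = matrix_rep_ext \<tau> f *v (matrix_rep_ext \<tau> h *v v)"
proof -
  have sum_mult: "B *v (\<Sum>q\<in>Q. w q) = (\<Sum>q\<in>Q. B *v w q)" for B :: "complex^'d^'d" and w :: "'g \<Rightarrow> _" and Q
    by (induction Q rule: infinite_finite_induct) (simp_all add: matrix_vector_right_distrib)
  let ?C = "(\<lambda>(p, q). p \<otimes>\<^bsub>\<Gamma>\<^esub> q) ` (supp f \<times> supp h)"
  have "matrix_rep_ext \<tau> (f \<otimes>\<^bsub>monoid_algebra \<Gamma>\<^esub> h) *v v =
      (\<Sum>r\<in>?C. bilinear_ext (monoid.mult \<Gamma>) f h r *s (\<tau> r *v v))"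
    unfolding matrix_rep_ext_mult_vec monoid_algebra_simps
    by (rule sum.mono_neutral_left) (use f h supp_bilinear_ext[of "monoid.mult \<Gamma>" f h] in \<open>auto simp: mem_monoid_algebra\<close>)
  also have "\<dots> = (\<Sum>p\<in>supp f. \<Sum>q\<in>supp h. (f p * h q) *s (\<tau> (p \<otimes>\<^bsub>\<Gamma>\<^esub> q) *v v))"
    \<comment> \<open>The support of the product may be smaller than the set of products
      \<open>?C\<close>, so the previous step enlarged the sum to \<open>?C\<close>; now each
      product r is replaced by the pairs that yield it.\<close>
    using f h by (intro sum_bilinear_ext[where h = "\<lambda>r a. a *s (\<tau> r *v v)"])
      (auto simp: mem_monoid_algebra vec.scale_left_distrib)
  also have "\<dots> = (\<Sum>p\<in>supp f. \<Sum>q\<in>supp h. f p *s (\<tau> p *v (h q *s (\<tau> q *v v))))"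
  proof (intro sum.cong refl)
    fix p q assume "p \<in> supp f" "q \<in> supp h"
    then have "\<tau> (p \<otimes>\<^bsub>\<Gamma>\<^esub> q) = \<tau> p ** \<tau> q"
      using \<tau> f h by (auto simp: matrix_rep_def mem_monoid_algebra)
    then show "(f p * h q) *s (\<tau> (p \<otimes>\<^bsub>\<Gamma>\<^esub> q) *v v) = f p *s (\<tau> p *v (h q *s (\<tau> q *v v)))"
      by (simp add: vector_scalar_commute matrix_vector_mul_assoc)
  qed
  also have "\<dots> = matrix_rep_ext \<tau> f *v (matrix_rep_ext \<tau> h *v v)"
    by (simp add: matrix_rep_ext_mult_vec sum_mult vec.scale_sum_right) (rule sum.swap)
  finally show ?thesis .
qed

lemma matrix_rep_ext_delta: "matrix_rep_ext \<tau> (delta g) *v v = \<tau> g *v v"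
  unfolding matrix_rep_ext_mult_vec supp_delta by (simp add: delta_def)

text \<open>A central f commutes with each \<open>delta g\<close>, so its matrix commutes with
  \<tau> g and equals some \<open>mat c\<close>. Its trace is the dimension times c, which is the
  origin of the normalization.\<close>

lemma matrix_rep_ext_center:
  fixes \<tau> :: "'g \<Rightarrow> complex^'d^'d"
  assumes \<tau>: "irreducible_matrix_rep \<Gamma> \<tau>" and f: "f \<in> algebra_center (monoid_algebra \<Gamma>)"
  shows "matrix_rep_ext \<tau> f = mat (1 / of_nat CARD('d) * trace (matrix_rep_ext \<tau> f))"
proof -
  have rep: "matrix_rep \<Gamma> \<tau>" using \<tau> by (simp add: irreducible_matrix_rep_def)
  have fc: "f \<in> carrier (monoid_algebra \<Gamma>)" using f by (simp add: algebra_center_def)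
  obtain c where c: "matrix_rep_ext \<tau> f = mat c"
  proof (rule schur[OF \<tau>])
    fix g v assume g: "g \<in> carrier \<Gamma>"
    then have d: "delta g \<in> carrier (monoid_algebra \<Gamma>)" by (simp add: delta_mem_monoid_algebra)
    have "f \<otimes>\<^bsub>monoid_algebra \<Gamma>\<^esub> delta g = delta g \<otimes>\<^bsub>monoid_algebra \<Gamma>\<^esub> f"
      using f d unfolding algebra_center_def by blast
    then show "matrix_rep_ext \<tau> f *v (\<tau> g *v v) = \<tau> g *v (matrix_rep_ext \<tau> f *v v)"
      using matrix_rep_ext_mult[OF rep fc d] matrix_rep_ext_mult[OF rep d fc]
      by (metis matrix_rep_ext_delta)
  qed
  have "trace (mat c :: complex^'d^'d) = of_nat CARD('d) * c"
    by (simp add: trace_def mat_def)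
  then show ?thesis by (simp add: c)
qed

section \<open>The algebras of the Dunkl setting\<close>

lemma complexify_simps [simp]:
  "carrier (complexify M) = carrier M \<times> carrier M"
  "(a, b) \<otimes>\<^bsub>complexify M\<^esub> (a', b') =
    ((a \<otimes>\<^bsub>M\<^esub> a') \<ominus>\<^bsub>M\<^esub> (b \<otimes>\<^bsub>M\<^esub> b'), (a \<otimes>\<^bsub>M\<^esub> b') \<oplus>\<^bsub>M\<^esub> (b \<otimes>\<^bsub>M\<^esub> a'))"
  "\<one>\<^bsub>complexify M\<^esub> = (\<one>\<^bsub>M\<^esub>, \<zero>\<^bsub>M\<^esub>)" "\<zero>\<^bsub>complexify M\<^esub> = (\<zero>\<^bsub>M\<^esub>, \<zero>\<^bsub>M\<^esub>)"
  "(a, b) \<oplus>\<^bsub>complexify M\<^esub> (a', b') = (a \<oplus>\<^bsub>M\<^esub> a', b \<oplus>\<^bsub>M\<^esub> b')"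
  "z \<odot>\<^bsub>complexify M\<^esub> (a, b) =
    ((Re z \<odot>\<^bsub>M\<^esub> a) \<oplus>\<^bsub>M\<^esub> ((- Im z) \<odot>\<^bsub>M\<^esub> b), (Re z \<odot>\<^bsub>M\<^esub> b) \<oplus>\<^bsub>M\<^esub> (Im z \<odot>\<^bsub>M\<^esub> a))"
  by (simp_all add: complexify_def)

lemma module_complexify:
  fixes M :: "(real, 'a) module"
  assumes "Module.module field_ring M"
  shows "Module.module field_ring (complexify M)"
proof -
  interpret module field_ring M by fact
  have l_distr: "(a + b) \<odot>\<^bsub>M\<^esub> x = (a \<odot>\<^bsub>M\<^esub> x) \<oplus>\<^bsub>M\<^esub> (b \<odot>\<^bsub>M\<^esub> x)"
    and assoc: "a \<odot>\<^bsub>M\<^esub> (b \<odot>\<^bsub>M\<^esub> x) = (a * b) \<odot>\<^bsub>M\<^esub> x"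
    and r_distr: "y \<in> carrier M \<Longrightarrow> a \<odot>\<^bsub>M\<^esub> (x \<oplus>\<^bsub>M\<^esub> y) = (a \<odot>\<^bsub>M\<^esub> x) \<oplus>\<^bsub>M\<^esub> (a \<odot>\<^bsub>M\<^esub> y)"
    and closed: "a \<odot>\<^bsub>M\<^esub> x \<in> carrier M"
    and unit: "1 \<odot>\<^bsub>M\<^esub> x = x" and null: "0 \<odot>\<^bsub>M\<^esub> x = \<zero>\<^bsub>M\<^esub>"
    if "x \<in> carrier M" for a b x y
    using that smult_l_distr[of a b x] smult_assoc1[of a b x] smult_r_distr[of a x y] smult_one[of x]
      smult_l_null[of x] by simp_all
  \<comment> \<open>Needed for products of complex scalars, whose real part is a difference of two
    products.\<close>
  have l_diff: "(a - b) \<odot>\<^bsub>M\<^esub> x = (a \<odot>\<^bsub>M\<^esub> x) \<oplus>\<^bsub>M\<^esub> ((- b) \<odot>\<^bsub>M\<^esub> x)" if "x \<in> carrier M" for a b x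
    using l_distr[OF that, of a "- b"] by simp
  show ?thesis
  proof (rule module_field_ringI)
    show "abelian_group (complexify M)"
    proof (rule abelian_groupI)
      fix p assume "p \<in> carrier (complexify M)"
      then show "\<exists>q\<in>carrier (complexify M). q \<oplus>\<^bsub>complexify M\<^esub> p = \<zero>\<^bsub>complexify M\<^esub>"
        by (auto intro!: bexI[of _ "(\<ominus>\<^bsub>M\<^esub> fst p, \<ominus>\<^bsub>M\<^esub> snd p)"] simp: M.l_neg)
    qed (auto simp: M.a_ac)
  qed (auto simp: closed l_distr l_diff r_distr assoc unit null M.a_ac mult_ac)
qed

section \<open>The reflection group and its action on the generating space\<close>

lemma refl_word_simps [simp]:
  "refl_word D [] = id" "refl_word D (\<alpha> # as) = reflection D \<alpha> \<circ> refl_word D as"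
  by (simp_all add: refl_word_def)

lemma refl_word_append: "refl_word D (as @ bs) = refl_word D as \<circ> refl_word D bs"
  by (induction as) (simp_all add: comp_assoc)

lemma id_in_refl_group: "id \<in> refl_group D"
  unfolding refl_group_def by (auto intro!: exI[of _ "[]"])

lemma reflection_in_refl_group: "\<alpha> \<in> roots D \<Longrightarrow> reflection D \<alpha> \<in> refl_group D"
  unfolding refl_group_def by (auto intro!: exI[of _ "[\<alpha>]"])

lemma comp_in_refl_group:
  assumes "w \<in> refl_group D" "w' \<in> refl_group D"
  shows "w \<circ> w' \<in> refl_group D"
proof -
  obtain as bs where "w = refl_word D as" "set as \<subseteq> roots D" "w' = refl_word D bs" "set bs \<subseteq> roots D"
    using assms unfolding refl_group_def by blast
  then show ?thesis
    unfolding refl_group_def by (auto simp flip: refl_word_append intro!: exI[of _ "as @ bs"])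
qed

text \<open>This supplies the linearity and bijectivity of w on which \<open>dual_act\<close>
  relies.\<close>

lemma refl_group_orthogonal:
  assumes "root_system D" "w \<in> refl_group D"
  shows "orthogonal_transformation w"
proof -
  have "orthogonal_transformation (refl_word D as)" if "set as \<subseteq> roots D" for as
    using that
  proof (induction as)
    case Nil
    show ?case by (simp add: orthogonal_transformation_id id_def)
  next
    case (Cons \<alpha> as)
    then show ?case
      using assms(1) unfolding refl_word_simps
      by (intro orthogonal_transformation_compose) (auto simp: root_system_def)
  qed
  then show ?thesis using assms(2) by (auto simp: refl_group_def)
qed

text \<open>\<open>Blinfun\<close> returns the intended functional only for a bounded linear
  argument; the inverse of an orthogonal map is orthogonal and therefore bounded linear.\<close>

lemma dual_act_apply:
  assumes "orthogonal_transformation w"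
  shows "blinfun_apply (dual_act w x) y = blinfun_apply x (inv_into UNIV w y)"
proof -
  have "bounded_linear (inv_into UNIV w)"
    using orthogonal_transformation_inv[OF assms]
    using linear_conv_bounded_linear orthogonal_transformation_linear by blast
  then have "bounded_linear (\<lambda>y. blinfun_apply x (inv_into UNIV w y))"
    by (intro bounded_linear_compose[OF blinfun.bounded_linear_right])
  then show ?thesis by (simp add: dual_act_def bounded_linear_Blinfun_apply)
qed

text \<open>On the dual, w acts by composing with its inverse on the right. Inversion reverses the
  order of factors and precomposition reverses it again, so this is a left action.\<close>

lemma group_act_comp:
  assumes "orthogonal_transformation w" "orthogonal_transformation w'"
  shows "group_act (w \<circ> w') = group_act w \<circ> group_act w'"
proof -
  have "dual_act (w \<circ> w') x = dual_act w (dual_act w' x)" for x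
    using assms orthogonal_transformation_compose[OF assms]
    by (intro blinfun_eqI) (simp add: dual_act_apply o_inv_distrib orthogonal_transformation_bij)
  then show ?thesis by (auto simp: fun_eq_iff)
qed

lemma group_act_id: "group_act id = id"
proof -
  have "dual_act id x = x" for x :: "'a::euclidean_space \<Rightarrow>\<^sub>L real"
    by (intro blinfun_eqI) (simp add: dual_act_apply orthogonal_transformation_id[unfolded id_def] id_def)
  then show ?thesis by (auto simp: fun_eq_iff)
qed

lemma carrier_h_dual_plus_h [simp]: "carrier h_dual_plus_h = UNIV"
  by (simp add: h_dual_plus_h_def direct_sum_def real_space_def)

text \<open>Associativity of the semidirect product amounts to \<open>group_act\<close> being an
  action on letters.\<close>

lemma monoid_smash:
  assumes "root_system D"
  shows "Group.monoid (smash_monoid D)"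
  by (rule monoidI)
    (auto simp: smash_monoid_def comp_in_refl_group id_in_refl_group group_act_id comp_assoc
      group_act_comp refl_group_orthogonal[OF assms])

lemma module_real_space: "Module.module field_ring (real_space :: (real, 'v::real_vector) module)"
proof (rule module_field_ringI)
  show "abelian_group (real_space :: (real, 'v) module)"
  proof (rule abelian_groupI)
    show "\<exists>y\<in>carrier real_space. y \<oplus>\<^bsub>real_space\<^esub> x = \<zero>\<^bsub>real_space\<^esub>" for x :: 'v
      by (auto simp: real_space_def intro: exI[of _ "- x"])
  qed (simp_all add: real_space_def algebra_simps)
qed (simp_all add: real_space_def algebra_simps)

lemma module_direct_sum:
  assumes "Module.module field_ring M" "Module.module field_ring N"
  shows "Module.module field_ring (direct_sum M N)"
proof -
  interpret M: module field_ring M by fact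
  interpret N: module field_ring N by fact
  have ds: "carrier (direct_sum M N) = carrier M \<times> carrier N"
    "(a, b) \<oplus>\<^bsub>direct_sum M N\<^esub> (a', b') = (a \<oplus>\<^bsub>M\<^esub> a', b \<oplus>\<^bsub>N\<^esub> b')"
    "r \<odot>\<^bsub>direct_sum M N\<^esub> (a, b) = (r \<odot>\<^bsub>M\<^esub> a, r \<odot>\<^bsub>N\<^esub> b)"
    "\<zero>\<^bsub>direct_sum M N\<^esub> = (\<zero>\<^bsub>M\<^esub>, \<zero>\<^bsub>N\<^esub>)" for a b a' b' r
    by (simp_all add: direct_sum_def)
  show ?thesis
  proof (rule module_field_ringI)
    show "abelian_group (direct_sum M N)"
    proof (rule abelian_groupI)
      fix p assume "p \<in> carrier (direct_sum M N)"
      then show "\<exists>q\<in>carrier (direct_sum M N). q \<oplus>\<^bsub>direct_sum M N\<^esub> p = \<zero>\<^bsub>direct_sum M N\<^esub>"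
        by (auto intro!: bexI[of _ "(\<ominus>\<^bsub>M\<^esub> fst p, \<ominus>\<^bsub>N\<^esub> snd p)"] simp: ds M.l_neg N.l_neg)
    qed (auto simp: ds M.a_ac N.a_ac)
  qed (use M.smult_l_distr N.smult_l_distr M.smult_r_distr N.smult_r_distr M.smult_assoc1 N.smult_assoc1
      M.smult_one N.smult_one in \<open>auto simp: ds\<close>)
qed

section \<open>The Cherednik algebra and the Dunkl angular momentum algebra inside it\<close>

lemma letter_closed: "letter v \<in> carrier (monoid_algebra (smash_monoid D))"
  by (simp add: letter_def delta_mem_monoid_algebra smash_monoid_def id_in_refl_group)

lemma x_letter_closed: "x_letter x \<in> carrier (monoid_algebra (smash_monoid D))"
  and y_letter_closed: "y_letter y \<in> carrier (monoid_algebra (smash_monoid D))"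
  by (simp_all add: x_letter_def y_letter_def letter_closed)

lemma group_letter_closed:
  "w \<in> refl_group D \<Longrightarrow> group_letter w \<in> carrier (monoid_algebra (smash_monoid D))"
  by (simp add: group_letter_def delta_mem_monoid_algebra smash_monoid_def)

lemma pos_roots_subset: "dunkl_setting D \<Longrightarrow> pos_roots D \<subseteq> roots D"
  by (auto simp: dunkl_setting_def positive_system_def)

context
  fixes D :: "'a::euclidean_space dunkl_data"
  assumes setting: "dunkl_setting D"
begin

lemma root_system: "root_system D"
  using setting by (simp add: dunkl_setting_def)

lemma pos_refl_in_refl_group: "\<alpha> \<in> pos_roots D \<Longrightarrow> reflection D \<alpha> \<in> refl_group D"
  using pos_roots_subset[OF setting] reflection_in_refl_group by blast

text \<open>\<open>Idl\<close> intersects all ideals containing the generators; if a generator fell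
  outside the carrier, there would be no such ideal and the intersection would degenerate to
  \<open>UNIV\<close>.\<close>

lemma cherednik_rels_subset:
  defines "F \<equiv> monoid_algebra (smash_monoid D) :: (complex, _) module"
  shows "linear_rels F h_dual_plus_h letter \<union>
      {commutator F (x_letter x) (x_letter x') | x x'. True} \<union>
      {commutator F (y_letter y) (y_letter y') | y y'. True} \<union>
      {commutator F (y_letter y) (x_letter x) \<ominus>\<^bsub>F\<^esub>
        ((pairing x y \<odot>\<^bsub>F\<^esub> \<one>\<^bsub>F\<^esub>) \<oplus>\<^bsub>F\<^esub>
         (\<Oplus>\<^bsub>F\<^esub>\<alpha>\<in>pos_roots D.
            (param D \<alpha> * pairing (\<alpha>, 0) y * pairing x (coroot D \<alpha>, 0)) \<odot>\<^bsub>F\<^esub>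
              group_letter (reflection D \<alpha>))) | x y. True} \<subseteq> carrier F"
proof -
  interpret R: ring F unfolding F_def by (rule ring_monoid_algebra[OF monoid_smash[OF root_system]])
  interpret M: module field_ring F unfolding F_def by (rule module_monoid_algebra)
  note closed = x_letter_closed[of _ D, folded F_def] y_letter_closed[of _ D, folded F_def]
    letter_closed[of _ D, folded F_def] group_letter_closed[of _ D, folded F_def]
  have smult: "a \<odot>\<^bsub>F\<^esub> f \<in> carrier F" if "f \<in> carrier F" for a f
    using that by simp
  have "linear_rels F h_dual_plus_h letter \<subseteq> carrier F"
    by (rule linear_rels_subset)
      (auto simp: closed h_dual_plus_h_def intro!: module_direct_sum module_complexify module_real_space M.module_axioms)
  moreover have "commutator F f g \<in> carrier F" if "f \<in> carrier F" "g \<in> carrier F" for f g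
    using that unfolding commutator_def by (intro R.minus_closed R.m_closed)
  ultimately show ?thesis
    using closed by (auto intro!: R.minus_closed R.a_closed R.one_closed R.finsum_closed smult
        closed(4)[OF pos_refl_in_refl_group])
qed

lemma ring_cherednik: "ring (cherednik D)"
  and module_cherednik: "Module.module field_ring (cherednik D)"
  and cherednik_class_closed:
    "f \<in> carrier (monoid_algebra (smash_monoid D)) \<Longrightarrow> cherednik_class D f \<in> carrier (cherednik D)"
  using quotient_monoid_algebra[OF monoid_smash[OF root_system] cherednik_rels_subset]
  unfolding cherednik_def cherednik_class_def cherednik_ideal_def Let_def by blast+

lemma ch_group_cherednik: "w \<in> refl_group D \<Longrightarrow> ch_group D w \<in> carrier (cherednik D)"
  by (simp add: ch_group_def cherednik_class_closed group_letter_closed)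

lemma ang_mom_cherednik: "ang_mom D i j \<in> carrier (cherednik D)"
proof -
  interpret ring "cherednik D" by (rule ring_cherednik)
  show ?thesis
    unfolding ang_mom_def ch_x_def ch_y_def
    by (intro minus_closed m_closed cherednik_class_closed x_letter_closed y_letter_closed)
qed

lemma dam_carrier:
  shows subring_dam: "subring (carrier (dam_algebra D)) (cherednik D)"
    and submodule_dam: "submodule (carrier (dam_algebra D)) field_ring (cherednik D)"
    and dam_gens: "ch_group D ` refl_group D \<union> {ang_mom D i j | i j. (i, j) \<in> index_pairs D} \<subseteq>
      carrier (dam_algebra D)"
proof -
  interpret ring "cherednik D" by (rule ring_cherednik)
  let ?S = "ch_group D ` refl_group D \<union> {ang_mom D i j | i j. (i, j) \<in> index_pairs D}"
  let ?\<H> = "{H. subring H (cherednik D) \<and> submodule H field_ring (cherednik D) \<and> ?S \<subseteq> H}"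
  have eq: "carrier (dam_algebra D) = \<Inter>?\<H>"
    by (simp add: dam_algebra_def subalgebra_generated_def)
  \<comment> \<open>The full Cherednik algebra belongs to the family, so the intersection is taken
    over a nonempty family and stays inside the carrier.\<close>
  have ne: "carrier (cherednik D) \<in> ?\<H>"
    using carrier_is_subring carrier_submodule[OF module_cherednik] ch_group_cherednik ang_mom_cherednik
    by auto
  show "subring (carrier (dam_algebra D)) (cherednik D)"
    unfolding eq using ne by (intro subring_Inter) auto
  show "submodule (carrier (dam_algebra D)) field_ring (cherednik D)"
    unfolding eq using ne by (intro submodule_Inter module_cherednik) auto
  show "?S \<subseteq> carrier (dam_algebra D)" unfolding eq by blast
qed

lemma module_dam: "Module.module field_ring (dam_algebra D)"
proof -
  have "dam_algebra D = (cherednik D)\<lparr>carrier := carrier (dam_algebra D)\<rparr>"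
    by (simp add: dam_algebra_def)
  then show ?thesis
    using submodule.submodule_is_module[OF submodule_dam module_cherednik] by simp
qed

lemma dam_mult: "monoid.mult (dam_algebra D) \<in> carrier (dam_algebra D) \<rightarrow> carrier (dam_algebra D) \<rightarrow> carrier (dam_algebra D)"
proof -
  have "monoid.mult (dam_algebra D) = monoid.mult (cherednik D)" by (simp add: dam_algebra_def)
  then show ?thesis using subringE(6)[OF subring_dam] by auto
qed

lemma ch_group_dam: "w \<in> refl_group D \<Longrightarrow> ch_group D w \<in> carrier (dam_algebra D)"
  using dam_gens by blast

lemma ang_mom_dam: "(i, j) \<in> index_pairs D \<Longrightarrow> ang_mom D i j \<in> carrier (dam_algebra D)"
  using dam_gens by blast

text \<open>The element is a combination of reflections and the unit, so it lies in the image of the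
  group algebra of W.\<close>

lemma phi_dam: "phi_elt D \<in> carrier (dam_algebra D)"
  unfolding phi_elt_def Let_def
  by (intro submodule_smult[OF submodule_dam] submodule_add[OF submodule_dam]
      submodule_finsum[OF module_cherednik submodule_dam] subringE(3)[OF subring_dam] Pi_I
      ch_group_dam pos_refl_in_refl_group)

end

section \<open>The Clifford algebra\<close>

lemma monoid_word: "Group.monoid (word_monoid :: 'a list monoid)"
  by (rule monoidI) (simp_all add: word_monoid_def)

lemma clifford_rels_subset:
  defines "F \<equiv> monoid_algebra word_monoid :: (real, 'a::euclidean_space list \<Rightarrow> real) module"
  shows "linear_rels F real_space (\<lambda>y. delta [y]) \<union>
      {((delta [y] \<otimes>\<^bsub>F\<^esub> delta [y']) \<oplus>\<^bsub>F\<^esub> (delta [y'] \<otimes>\<^bsub>F\<^esub> delta [y])) \<ominus>\<^bsub>F\<^esub> ((2 * (y \<bullet> y')) \<odot>\<^bsub>F\<^esub> \<one>\<^bsub>F\<^esub>) | y y'. True}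
    \<subseteq> carrier F"
proof -
  interpret R: ring F unfolding F_def by (rule ring_monoid_algebra[OF monoid_word])
  interpret M: module field_ring F unfolding F_def by (rule module_monoid_algebra)
  have closed: "delta w \<in> carrier F" for w :: "'a list"
    by (simp add: F_def delta_mem_monoid_algebra word_monoid_def)
  have smult: "a \<odot>\<^bsub>F\<^esub> f \<in> carrier F" if "f \<in> carrier F" for a f
    using that by simp
  have "linear_rels F real_space (\<lambda>y. delta [y]) \<subseteq> carrier F"
    by (rule linear_rels_subset) (auto simp: closed intro!: module_real_space M.module_axioms)
  then show ?thesis
    using closed by (auto intro!: R.minus_closed R.a_closed R.one_closed R.m_closed smult)
qed

lemma ring_clifford: "ring clifford"
  and module_clifford: "Module.module field_ring clifford"
  and cl_vec_closed: "cl_vec y \<in> carrier clifford"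
proof -
  note quot = quotient_monoid_algebra[OF monoid_word clifford_rels_subset]
  show "ring clifford" "Module.module field_ring clifford"
    using quot(1,2) unfolding clifford_def clifford_ideal_def Let_def by blast+
  show "cl_vec y \<in> carrier clifford"
    using quot(3)[of "delta [y]"] unfolding clifford_def clifford_ideal_def cl_vec_def Let_def
    by (simp add: delta_mem_monoid_algebra word_monoid_def)
qed

lemma module_clifford_cx: "Module.module field_ring clifford_cx"
  unfolding clifford_cx_def by (rule module_complexify[OF module_clifford])

lemma clifford_cx_mult: "monoid.mult clifford_cx \<in> carrier clifford_cx \<rightarrow> carrier clifford_cx \<rightarrow> carrier clifford_cx"
proof -
  interpret ring clifford by (rule ring_clifford)
  show ?thesis by (auto simp: clifford_cx_def intro!: minus_closed)
qed

lemma cl_embed_closed: "\<eta> \<in> carrier clifford \<Longrightarrow> cl_embed \<eta> \<in> carrier clifford_cx"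
  and clifford_cx_one: "\<one>\<^bsub>clifford_cx\<^esub> \<in> carrier clifford_cx"
proof -
  interpret ring clifford by (rule ring_clifford)
  show "\<eta> \<in> carrier clifford \<Longrightarrow> cl_embed \<eta> \<in> carrier clifford_cx" "\<one>\<^bsub>clifford_cx\<^esub> \<in> carrier clifford_cx"
    using zero_closed one_closed by (simp_all only: clifford_cx_def cl_embed_def complexify_simps mem_Times_iff fst_conv snd_conv)
qed

section \<open>The Dirac element and the central character\<close>

context
  fixes D :: "'a::euclidean_space dunkl_data"
  assumes setting: "dunkl_setting D"
begin

lemma module_dam_cliff: "Module.module field_ring (dam_cliff D)"
  unfolding dam_cliff_def by (intro module_tensor module_dam[OF setting] module_clifford_cx)

lemma dc_tens_closed:
  "x \<in> carrier (dam_algebra D) \<Longrightarrow> \<eta> \<in> carrier clifford_cx \<Longrightarrow> dc_tens D x \<eta> \<in> carrier (dam_cliff D)"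
  unfolding dc_tens_def dam_cliff_def by (rule tens_closed)

lemma rho_group_closed:
  assumes "g \<in> carrier (hat_group D)"
  shows "rho_group D g \<in> carrier (dam_cliff D)"
proof -
  obtain \<eta> s where g: "g = (\<eta>, s)" "\<eta> \<in> pin" "pin_proj \<eta> \<in> refl_group D"
    using assms by (auto simp: hat_group_def pin_cover_def)
  have "\<eta> \<in> carrier clifford" using g(2) by (auto simp: pin_def Units_def)
  \<comment> \<open>For s = -1 the group component is
    \<open>pin_proj \<eta> \<circ> longest D\<close>.\<close>
  moreover have "longest D \<in> refl_group D" using setting by (simp add: dunkl_setting_def)
  ultimately show ?thesis
    using g by (auto simp: rho_group_def intro!: dc_tens_closed cl_embed_closed ch_group_dam[OF setting] comp_in_refl_group)
qed

lemma rho_closed: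
  assumes "f \<in> carrier (hat_algebra D)"
  shows "rho D f \<in> carrier (dam_cliff D)"
  unfolding rho_def
  by (rule submodule_finsum[OF module_dam_cliff carrier_submodule[OF module_dam_cliff]])
    (use assms in \<open>auto simp: hat_algebra_def mem_monoid_algebra intro!: rho_group_closed
      submodule_smult[OF carrier_submodule[OF module_dam_cliff]]\<close>)

lemma dirac_closed:
  assumes "admissible D C"
  shows "dirac D C \<in> carrier (dam_cliff D)"
proof -
  interpret module field_ring "dam_cliff D" by (rule module_dam_cliff)
  have "C \<in> carrier (hat_algebra D)" using assms by (simp add: admissible_def algebra_center_def)
  then have "rho D C \<in> carrier (dam_cliff D)" by (rule rho_closed)
  moreover have "dc_tens D (phi_elt D) \<one>\<^bsub>clifford_cx\<^esub> \<in> carrier (dam_cliff D)"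
    by (intro dc_tens_closed phi_dam[OF setting] clifford_cx_one)
  moreover have "ama_dirac D \<in> carrier (dam_cliff D)"
    unfolding ama_dirac_def
    by (intro M.finsum_closed) (auto intro!: dc_tens_closed ang_mom_dam[OF setting]
        clifford_cx_mult[THEN funcset_mem, THEN funcset_mem] cl_embed_closed cl_vec_closed)
  ultimately show ?thesis unfolding dirac_def by (intro M.a_closed M.minus_closed)
qed

end

theorem theorem5p12:
  fixes D :: "'a::euclidean_space dunkl_data"
    and \<sigma> :: "'a cliff \<times> 'a cliff \<Rightarrow> 's \<Rightarrow> 's" and S :: "(complex, 's) module"
    and C :: "'a hat_elt \<Rightarrow> complex"
    and \<zeta> :: "'a cherednik_elt \<Rightarrow> 'a hat_elt \<Rightarrow> complex"
    and \<tau> :: "'a hat_elt \<Rightarrow> complex^'d^'d"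
    and \<pi> :: "'a cherednik_elt \<Rightarrow> 'x \<Rightarrow> 'x" and V :: "(complex, 'x) module"
    and chi :: "'a cherednik_elt \<Rightarrow> complex"
  assumes setting: "dunkl_setting D"
    and spin: "irreducible_rep clifford_cx \<sigma> S"
    and adm: "admissible D C"
    and zeta_hom: "\<zeta> \<in> algebra_hom (center_algebra (dam_algebra D)) (center_algebra (hat_algebra D))"
    and zeta: "\<forall>z\<in>algebra_center (dam_algebra D). \<exists>a\<in>carrier (dam_cliff D).
      dc_tens D z \<one>\<^bsub>clifford_cx\<^esub> =
        rho D (\<zeta> z) \<oplus>\<^bsub>dam_cliff D\<^esub> (dirac D C \<otimes>\<^bsub>dam_cliff D\<^esub> a)
          \<oplus>\<^bsub>dam_cliff D\<^esub> (a \<otimes>\<^bsub>dam_cliff D\<^esub> dirac D C)"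
    and tau: "irreducible_matrix_rep (hat_group D) \<tau>"
    and rep: "algebra_rep (dam_algebra D) \<pi> V"
    and central_char: "\<forall>z\<in>algebra_center (dam_algebra D). \<forall>x\<in>carrier V. \<pi> z x = chi z \<odot>\<^bsub>V\<^esub> x"
    and hom_nonzero: "\<exists>F \<in> intertwiners (hat_group D) \<tau>
        (dirac_cohomology_act D C \<pi> V \<sigma> S) (dirac_cohomology D C \<pi> V \<sigma> S).
      F \<noteq> (\<lambda>_. \<zero>\<^bsub>dirac_cohomology D C \<pi> V \<sigma> S\<^esub>)"
  shows "\<forall>z\<in>algebra_center (dam_algebra D). chi z = normalized_character \<tau> \<zeta> z"
proof
  fix z assume z: "z \<in> algebra_center (dam_algebra D)"
  interpret T: tensor_of_reps "dam_algebra D" clifford_cx V S \<pi> \<sigma>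
    using spin by (intro tensor_of_reps.intro module_dam dam_mult setting module_clifford_cx
      clifford_cx_mult rep) (simp add: irreducible_rep_def)
  \<comment> \<open>The locale speaks of \<open>tensor (dam_algebra D) clifford_cx\<close>;
    rewriting with this equation restates its facts for \<open>dam_cliff D\<close>.\<close>
  note dc = dam_cliff_def[of D, symmetric]
  interpret W: module field_ring "tensor V S" by (rule T.W_module)
  let ?d = "dirac D C" and ?K = "dirac_ker D C \<pi> V \<sigma> S" and ?Y = "dirac_im D C \<pi> V \<sigma> S"
    and ?P = "\<lambda>g. tensor_rep V S \<pi> \<sigma> (rho_group D g)"
  have d: "?d \<in> carrier (dam_cliff D)" by (rule dirac_closed[OF setting adm])
  obtain \<Phi> where \<Phi>: "\<Phi> \<in> intertwiners (hat_group D) \<tau>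
      (dirac_cohomology_act D C \<pi> V \<sigma> S) (dirac_cohomology D C \<pi> V \<sigma> S)"
    and \<Phi>0: "\<Phi> \<noteq> (\<lambda>_. ?K \<inter> ?Y)"
    using hom_nonzero by (auto simp: dirac_cohomology_def)
  have K: "submodule ?K field_ring (tensor V S)"
    using T.submodule_T_ker[unfolded dc, OF d] by (simp add: dirac_ker_def dirac_op_def)
  have Y: "submodule ?Y field_ring (tensor V S)"
    using T.submodule_T_image[unfolded dc, OF d] by (simp add: dirac_im_def dirac_op_def)
  interpret \<Phi>: subquotient_intertwiner "tensor V S" ?K ?Y "hat_group D" \<tau> ?P \<Phi>
    using \<Phi> by (intro subquotient_intertwiner.intro T.W_module K Y)
      (simp add: dirac_cohomology_def dirac_cohomology_act_def[abs_def])
  \<comment> \<open>The target of \<zeta> is the centre of the group algebra, which is what makes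
    Schur's lemma applicable to the matrix of \<zeta> z.\<close>
  have \<zeta>z: "\<zeta> z \<in> algebra_center (hat_algebra D)"
    using zeta_hom z by (auto simp: algebra_hom_def ring_hom_def center_algebra_def)
  then have \<zeta>c: "\<zeta> z \<in> carrier (hat_algebra D)" by (simp add: algebra_center_def)
  then have fin: "finite (supp (\<zeta> z))" "supp (\<zeta> z) \<subseteq> carrier (hat_group D)"
    by (auto simp: hat_algebra_def mem_monoid_algebra)
  obtain a where a: "a \<in> carrier (dam_cliff D)" and eq: "dc_tens D z \<one>\<^bsub>clifford_cx\<^esub> =
      rho D (\<zeta> z) \<oplus>\<^bsub>dam_cliff D\<^esub> (?d \<otimes>\<^bsub>dam_cliff D\<^esub> a) \<oplus>\<^bsub>dam_cliff D\<^esub> (a \<otimes>\<^bsub>dam_cliff D\<^esub> ?d)"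
    using zeta z by blast
  have zc: "z \<in> carrier (dam_algebra D)" using z by (simp add: algebra_center_def)
  show "chi z = normalized_character \<tau> \<zeta> z"
    unfolding normalized_character_def
  proof (rule \<Phi>.scalar_eqI[OF \<Phi>0 fin])
    show "?P g u \<in> carrier (tensor V S)" if "g \<in> carrier (hat_group D)" "u \<in> carrier (tensor V S)" for g u
      using T.T_closed[unfolded dc] rho_group_closed[OF setting] that by blast
    show "matrix_rep_ext \<tau> (\<zeta> z) =
        mat (1 / of_nat CARD('d) * trace (matrix_rep_ext \<tau> (\<zeta> z)))"
      by (rule matrix_rep_ext_center[OF tau \<zeta>z[unfolded hat_algebra_def]])
    fix u assume "u \<in> ?K"
    then have u: "u \<in> carrier (tensor V S)" and du: "tensor_rep V S \<pi> \<sigma> ?d u = \<zero>\<^bsub>tensor V S\<^esub>"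
      by (simp_all add: dirac_ker_def dirac_op_def)
    let ?r = "\<Oplus>\<^bsub>tensor V S\<^esub>g\<in>supp (\<zeta> z). \<zeta> z g \<odot>\<^bsub>tensor V S\<^esub> ?P g u"
    let ?y = "tensor_rep V S \<pi> \<sigma> ?d (tensor_rep V S \<pi> \<sigma> a u)"
    have rg: "rho_group D g \<in> carrier (dam_cliff D)" if "g \<in> supp (\<zeta> z)" for g
      using rho_group_closed[OF setting] fin that by blast
    \<comment> \<open>\<rho> is a finite sum over group elements; linearity of the action turns it
      into the sum of the \<open>?P g u\<close> that \<open>scalar_eqI\<close> expects.\<close>
    have r_eq: "tensor_rep V S \<pi> \<sigma> (rho D (\<zeta> z)) u = ?r"
    proof -
      interpret A: module field_ring "dam_cliff D" by (rule module_dam_cliff[OF setting])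
      have "tensor_rep V S \<pi> \<sigma> (rho D (\<zeta> z)) u =
          (\<Oplus>\<^bsub>tensor V S\<^esub>g\<in>supp (\<zeta> z). tensor_rep V S \<pi> \<sigma> (\<zeta> z g \<odot>\<^bsub>dam_cliff D\<^esub> rho_group D g) u)"
        unfolding rho_def using rg A.smult_closed by (intro T.T_finsum[unfolded dc] fin u) auto
      also have "\<dots> = ?r"
        using rg u T.T_closed[unfolded dc] W.smult_closed
        by (intro W.M.finsum_cong') (auto simp: T.T_smult_left[unfolded dc])
      finally show ?thesis .
    qed
    have au: "tensor_rep V S \<pi> \<sigma> a u \<in> carrier (tensor V S)"
      using T.T_closed[unfolded dc] a u by blast
    have y: "?y \<in> ?Y" using au by (simp add: dirac_im_def dirac_op_def)
    have rc: "?r \<in> carrier (tensor V S)"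
      using T.T_closed[unfolded dc, OF rho_closed[OF setting \<zeta>c] u] by (simp add: r_eq)
    have "chi z \<odot>\<^bsub>tensor V S\<^esub> u = tensor_rep V S \<pi> \<sigma> (dc_tens D z \<one>\<^bsub>clifford_cx\<^esub>) u"
      using T.T_tens_scalar[OF zc _ clifford_cx_one u] central_char z by (simp add: dc_tens_def)
    also have "\<dots> = tensor_rep V S \<pi> \<sigma> (rho D (\<zeta> z)) u \<oplus>\<^bsub>tensor V S\<^esub> ?y
        \<oplus>\<^bsub>tensor V S\<^esub> tensor_rep V S \<pi> \<sigma> a (tensor_rep V S \<pi> \<sigma> ?d u)"
      by (rule T.T_anticommutator[unfolded dc, OF dc_tens_closed[OF setting zc clifford_cx_one]
            rho_closed[OF setting \<zeta>c] d a u eq])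
    \<comment> \<open>The last term is a applied to the image of u under the Dirac operator, which
      is zero for u in the kernel.\<close>
    also have "\<dots> = ?r \<oplus>\<^bsub>tensor V S\<^esub> ?y"
      using rc T.T_closed[unfolded dc, OF d au] by (simp add: r_eq du T.T_zero_right[unfolded dc, OF a])
    finally show "\<exists>y\<in>?Y. chi z \<odot>\<^bsub>tensor V S\<^esub> u = ?r \<oplus>\<^bsub>tensor V S\<^esub> y"
      using y by blast
  qed
qed

end
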